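(* Let $M=(M,d_M)$, $N=(N,d_N)$ be chain complexes and $(F,G,H,L)$ a homotopy equivalence, i.e. $F:M\to N$, $G:N\to M$ are degree $0$ chain maps and $H:M\to M$, $L:N\to N$ are degree $1$ maps with $GF-1_M=d_MH+Hd_M$ and $FG-1_N=d_NL+Ld_N$. By changing either $H$ or $L$ one may always achieve that the obstruction $[\mathfrak o]$ vanishes, i.e. that the homotopy equivalence extends to a strong one. Examples of such changes are $$(F,G,H,L)\longmapsto(F,G,H-G(FH-LF),L)\quad\text{and}\quad(F,G,H,L)\longmapsto(F,G,H,L-F(GL-HG)):$$ each of the two quadruples on the right is a homotopy equivalence whose obstruction $[\mathfrak o]$ vanishes, hence it extends to a strong homotopy equivalence.
   Context: Chain complexes are $\mathbb Z$-graded complexes of abelian groups with differential of degree $-1$. $\mathrm{Hom}(M,N)$ is the complex of linear maps with differential $\phi\mapsto d_N\phi-(-1)^{\deg\phi}\phi d_M$. Obstruction: for a homotopy equivalence $(F,G,H,L)$, $\mathfrak o_M=FH-LF\in\mathrm{Hom}_1(M,N)$ and $\mathfrak o_N=GL-HG\in\mathrm{Hom}_1(N,M)$ are cycles; $[\mathfrak o]$ denotes either of the homology classes $[\mathfrak o_M]\in H_1(\mathrm{Hom}(M,N))$, $[\mathfrak o_N]\in H_1(\mathrm{Hom}(N,M))$ (one vanishes iff the other does). Strong homotopy equivalence: a family of degree $2m$ maps $F_{2m}:M\to N$, $G_{2m}:N\to M$ and degree $2m+1$ maps $H_{2m+1}:M\to M$, $L_{2m+1}:N\to N$, $m\ge0$,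 such that $F_0d_M=d_NF_0$, $G_0d_N=d_MG_0$, $G_0F_0-1_M=d_MH_1+H_1d_M$, $F_0G_0-1_N=d_NL_1+L_1d_N$, and for each $m\ge1$ $$d_NF_{2m}-F_{2m}d_M=\sum_{0\le i<m}(F_{2i}H_{2(m-i)-1}-L_{2(m-i)-1}F_{2i}),$$ $$d_MH_{2m+1}+H_{2m+1}d_M=\sum_{0\le j\le m}G_{2j}F_{2(m-j)}-\sum_{0\le j<m}H_{2j+1}H_{2(m-j)-1},$$ $$d_MG_{2m}-G_{2m}d_N=\sum_{0\le i<m}(G_{2i}L_{2(m-i)-1}-H_{2(m-i)-1}G_{2i}),$$ $$d_NL_{2m+1}+L_{2m+1}d_N=\sum_{0\le j\le m}F_{2j}G_{2(m-j)}-\sum_{0\le j<m}L_{2j+1}L_{2(m-j)-1}.$$ It extends $(F,G,H,L)$ if $F_0=F$, $G_0=G$, $H_1=H$, $L_1=L$. *)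

theory Defs
  imports "HOL-Algebra.AbelCoset"
begin

section \<open>Chain complexes and their homology\<close>

text \<open>
  Abelian groups are written additively, as in the library locale \<^locale>\<open>abelian_group\<close>: only the
  carrier, the addition and the zero of a record of type \<^typ>\<open>'a ring\<close> matter; its multiplicative
  fields are never used.
\<close>

record 'a chain_cpx =
  grp :: "int \<Rightarrow> 'a ring"
  bd :: "int \<Rightarrow> 'a \<Rightarrow> 'a"

locale chain_complex =
  fixes M :: "'a chain_cpx"
  assumes bd_hom: "abelian_group_hom (grp M n) (grp M (n - 1)) (bd M n)"
    and bd_bd: "x \<in> carrier (grp M n) \<Longrightarrow> bd M (n - 1) (bd M n x) = \<zero>\<^bsub>grp M (n - 2)\<^esub>"

definition cycles :: "'a chain_cpx \<Rightarrow> int \<Rightarrow> 'a ring" where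
  "cycles M n = (grp M n)\<lparr>carrier := {x \<in> carrier (grp M n). bd M n x = \<zero>\<^bsub>grp M (n - 1)\<^esub>}\<rparr>"

definition boundaries :: "'a chain_cpx \<Rightarrow> int \<Rightarrow> 'a set" where
  "boundaries M n = bd M (n + 1) ` carrier (grp M (n + 1))"

definition homology :: "'a chain_cpx \<Rightarrow> int \<Rightarrow> 'a set monoid" where
  "homology M n = cycles M n A_Mod boundaries M n"

definition homology_class :: "'a chain_cpx \<Rightarrow> int \<Rightarrow> 'a \<Rightarrow> 'a set" where
  "homology_class M n x = boundaries M n +>\<^bsub>cycles M n\<^esub> x"


section \<open>Graded maps and the complex of linear maps\<close>

text \<open>
  A graded map \<open>\<phi>\<close> of degree \<open>k\<close> has components \<open>\<phi> n\<close> from degree \<open>n\<close> to degree \<open>n + k\<close>.  Its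
  components are \<^const>\<open>undefined\<close> outside the carriers, so that equality of graded maps means equality
  on all elements of the source complex, and the graded maps of degree \<open>k\<close> form an abelian group.
\<close>

definition graded_maps :: "'a chain_cpx \<Rightarrow> 'b chain_cpx \<Rightarrow> int \<Rightarrow> (int \<Rightarrow> 'a \<Rightarrow> 'b) set" where
  "graded_maps M N k = {\<phi>. \<forall>n. \<phi> n \<in> extensional (carrier (grp M n)) \<and>
     \<phi> n \<in> hom (add_monoid (grp M n)) (add_monoid (grp N (n + k)))}"

definition Hom_grp :: "'a chain_cpx \<Rightarrow> 'b chain_cpx \<Rightarrow> int \<Rightarrow> (int \<Rightarrow> 'a \<Rightarrow> 'b) ring" where
  "Hom_grp M N k =
    \<lparr>carrier = graded_maps M N k, mult = undefined, one = undefined,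
     zero = (\<lambda>n. \<lambda>x\<in>carrier (grp M n). \<zero>\<^bsub>grp N (n + k)\<^esub>),
     add = (\<lambda>\<phi> \<psi> n. \<lambda>x\<in>carrier (grp M n). \<phi> n x \<oplus>\<^bsub>grp N (n + k)\<^esub> \<psi> n x)\<rparr>"

text \<open>
  In \<open>\<psi> \<star>\<^bsub>M,k\<^esub> \<phi>\<close>, the composite of \<open>\<psi>\<close> after \<open>\<phi>\<close>, the subscripts are the source and the degree of the
  inner map \<open>\<phi>\<close>.
\<close>

definition graded_comp ::
    "(int \<Rightarrow> 'b \<Rightarrow> 'c) \<Rightarrow> 'a chain_cpx \<Rightarrow> int \<Rightarrow> (int \<Rightarrow> 'a \<Rightarrow> 'b) \<Rightarrow> (int \<Rightarrow> 'a \<Rightarrow> 'c)"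
    (\<open>(_ \<star>\<^bsub>_,_\<^esub> _)\<close> [76, 0, 0, 75] 75) where
  "\<psi> \<star>\<^bsub>M,k\<^esub> \<phi> = (\<lambda>n. \<lambda>x\<in>carrier (grp M n). \<psi> (n + k) (\<phi> n x))"

definition id_map :: "'a chain_cpx \<Rightarrow> int \<Rightarrow> 'a \<Rightarrow> 'a" where
  "id_map M = (\<lambda>n. \<lambda>x\<in>carrier (grp M n). x)"

text \<open>The differential is \<open>\<phi> \<mapsto> d\<^sub>N \<phi> - (-1)\<^sup>k \<phi> d\<^sub>M\<close> in degree \<open>k\<close>.\<close>

definition Hom :: "'a chain_cpx \<Rightarrow> 'b chain_cpx \<Rightarrow> (int \<Rightarrow> 'a \<Rightarrow> 'b) chain_cpx" where
  "Hom M N =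
    \<lparr>grp = Hom_grp M N,
     bd = (\<lambda>k \<phi>. if even k
        then (bd N \<star>\<^bsub>M,k\<^esub> \<phi>) \<ominus>\<^bsub>Hom_grp M N (k - 1)\<^esub> (\<phi> \<star>\<^bsub>M,-1\<^esub> bd M)
        else (bd N \<star>\<^bsub>M,k\<^esub> \<phi>) \<oplus>\<^bsub>Hom_grp M N (k - 1)\<^esub> (\<phi> \<star>\<^bsub>M,-1\<^esub> bd M))\<rparr>"


section \<open>Homotopy equivalences and their obstruction\<close>

definition homotopy_equivalence ::
    "'a chain_cpx \<Rightarrow> 'b chain_cpx \<Rightarrow> (int \<Rightarrow> 'a \<Rightarrow> 'b) \<Rightarrow> (int \<Rightarrow> 'b \<Rightarrow> 'a) \<Rightarrow>
     (int \<Rightarrow> 'a \<Rightarrow> 'a) \<Rightarrow> (int \<Rightarrow> 'b \<Rightarrow> 'b) \<Rightarrow> bool" where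
  "homotopy_equivalence M N F G H L \<longleftrightarrow>
     F \<in> graded_maps M N 0 \<and> G \<in> graded_maps N M 0 \<and>
     H \<in> graded_maps M M 1 \<and> L \<in> graded_maps N N 1 \<and>
     F \<star>\<^bsub>M,-1\<^esub> bd M = bd N \<star>\<^bsub>M,0\<^esub> F \<and>
     G \<star>\<^bsub>N,-1\<^esub> bd N = bd M \<star>\<^bsub>N,0\<^esub> G \<and>
     (G \<star>\<^bsub>M,0\<^esub> F) \<ominus>\<^bsub>Hom_grp M M 0\<^esub> id_map M
       = (bd M \<star>\<^bsub>M,1\<^esub> H) \<oplus>\<^bsub>Hom_grp M M 0\<^esub> (H \<star>\<^bsub>M,-1\<^esub> bd M) \<and>
     (F \<star>\<^bsub>N,0\<^esub> G) \<ominus>\<^bsub>Hom_grp N N 0\<^esub> id_map N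
       = (bd N \<star>\<^bsub>N,1\<^esub> L) \<oplus>\<^bsub>Hom_grp N N 0\<^esub> (L \<star>\<^bsub>N,-1\<^esub> bd N)"

definition obstruction_M ::
    "'a chain_cpx \<Rightarrow> 'b chain_cpx \<Rightarrow> (int \<Rightarrow> 'a \<Rightarrow> 'b) \<Rightarrow> (int \<Rightarrow> 'b \<Rightarrow> 'a) \<Rightarrow>
     (int \<Rightarrow> 'a \<Rightarrow> 'a) \<Rightarrow> (int \<Rightarrow> 'b \<Rightarrow> 'b) \<Rightarrow> (int \<Rightarrow> 'a \<Rightarrow> 'b)" where
  "obstruction_M M N F G H L = (F \<star>\<^bsub>M,1\<^esub> H) \<ominus>\<^bsub>Hom_grp M N 1\<^esub> (L \<star>\<^bsub>M,0\<^esub> F)"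

definition obstruction_N ::
    "'a chain_cpx \<Rightarrow> 'b chain_cpx \<Rightarrow> (int \<Rightarrow> 'a \<Rightarrow> 'b) \<Rightarrow> (int \<Rightarrow> 'b \<Rightarrow> 'a) \<Rightarrow>
     (int \<Rightarrow> 'a \<Rightarrow> 'a) \<Rightarrow> (int \<Rightarrow> 'b \<Rightarrow> 'b) \<Rightarrow> (int \<Rightarrow> 'b \<Rightarrow> 'a)" where
  "obstruction_N M N F G H L = (G \<star>\<^bsub>N,1\<^esub> L) \<ominus>\<^bsub>Hom_grp N M 1\<^esub> (H \<star>\<^bsub>N,0\<^esub> G)"

text \<open>The two classes vanish simultaneously; the definition asks for both.\<close>

definition obstruction_vanishes ::
    "'a chain_cpx \<Rightarrow> 'b chain_cpx \<Rightarrow> (int \<Rightarrow> 'a \<Rightarrow> 'b) \<Rightarrow> (int \<Rightarrow> 'b \<Rightarrow> 'a) \<Rightarrow>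
     (int \<Rightarrow> 'a \<Rightarrow> 'a) \<Rightarrow> (int \<Rightarrow> 'b \<Rightarrow> 'b) \<Rightarrow> bool" where
  "obstruction_vanishes M N F G H L \<longleftrightarrow>
     homology_class (Hom M N) 1 (obstruction_M M N F G H L) = \<one>\<^bsub>homology (Hom M N) 1\<^esub> \<and>
     homology_class (Hom N M) 1 (obstruction_N M N F G H L) = \<one>\<^bsub>homology (Hom N M) 1\<^esub>"


section \<open>Strong homotopy equivalences\<close>

text \<open>
  All families are indexed by the degree of their members: only the even members of \<open>F\<close> and \<open>G\<close> and the
  odd members of \<open>H\<close> and \<open>L\<close> are relevant.  No natural-number subtraction below truncates.
\<close>

definition strong_homotopy_equivalence ::
    "'a chain_cpx \<Rightarrow> 'b chain_cpx \<Rightarrow>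
     (nat \<Rightarrow> int \<Rightarrow> 'a \<Rightarrow> 'b) \<Rightarrow> (nat \<Rightarrow> int \<Rightarrow> 'b \<Rightarrow> 'a) \<Rightarrow>
     (nat \<Rightarrow> int \<Rightarrow> 'a \<Rightarrow> 'a) \<Rightarrow> (nat \<Rightarrow> int \<Rightarrow> 'b \<Rightarrow> 'b) \<Rightarrow> bool" where
  "strong_homotopy_equivalence M N F G H L \<longleftrightarrow>
    (\<forall>m. F (2*m) \<in> graded_maps M N (int (2*m)) \<and>
         G (2*m) \<in> graded_maps N M (int (2*m)) \<and>
         H (2*m+1) \<in> graded_maps M M (int (2*m+1)) \<and>
         L (2*m+1) \<in> graded_maps N N (int (2*m+1))) \<and>
    F 0 \<star>\<^bsub>M,-1\<^esub> bd M = bd N \<star>\<^bsub>M,0\<^esub> F 0 \<and>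
    G 0 \<star>\<^bsub>N,-1\<^esub> bd N = bd M \<star>\<^bsub>N,0\<^esub> G 0 \<and>
    (G 0 \<star>\<^bsub>M,0\<^esub> F 0) \<ominus>\<^bsub>Hom_grp M M 0\<^esub> id_map M
      = (bd M \<star>\<^bsub>M,1\<^esub> H 1) \<oplus>\<^bsub>Hom_grp M M 0\<^esub> (H 1 \<star>\<^bsub>M,-1\<^esub> bd M) \<and>
    (F 0 \<star>\<^bsub>N,0\<^esub> G 0) \<ominus>\<^bsub>Hom_grp N N 0\<^esub> id_map N
      = (bd N \<star>\<^bsub>N,1\<^esub> L 1) \<oplus>\<^bsub>Hom_grp N N 0\<^esub> (L 1 \<star>\<^bsub>N,-1\<^esub> bd N) \<and>
    (\<forall>m\<ge>1.
      (bd N \<star>\<^bsub>M,int (2*m)\<^esub> F (2*m)) \<ominus>\<^bsub>Hom_grp M N (int (2*m-1))\<^esub> (F (2*m) \<star>\<^bsub>M,-1\<^esub> bd M)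
        = (\<Oplus>\<^bsub>Hom_grp M N (int (2*m-1))\<^esub>i\<in>{0..<m}.
            (F (2*i) \<star>\<^bsub>M,int (2*(m-i)-1)\<^esub> H (2*(m-i)-1))
              \<ominus>\<^bsub>Hom_grp M N (int (2*m-1))\<^esub> (L (2*(m-i)-1) \<star>\<^bsub>M,int (2*i)\<^esub> F (2*i))) \<and>
      (bd M \<star>\<^bsub>M,int (2*m+1)\<^esub> H (2*m+1)) \<oplus>\<^bsub>Hom_grp M M (int (2*m))\<^esub> (H (2*m+1) \<star>\<^bsub>M,-1\<^esub> bd M)
        = (\<Oplus>\<^bsub>Hom_grp M M (int (2*m))\<^esub>j\<in>{0..m}.
            G (2*j) \<star>\<^bsub>M,int (2*(m-j))\<^esub> F (2*(m-j)))
          \<ominus>\<^bsub>Hom_grp M M (int (2*m))\<^esub>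
          (\<Oplus>\<^bsub>Hom_grp M M (int (2*m))\<^esub>j\<in>{0..<m}.
            H (2*j+1) \<star>\<^bsub>M,int (2*(m-j)-1)\<^esub> H (2*(m-j)-1)) \<and>
      (bd M \<star>\<^bsub>N,int (2*m)\<^esub> G (2*m)) \<ominus>\<^bsub>Hom_grp N M (int (2*m-1))\<^esub> (G (2*m) \<star>\<^bsub>N,-1\<^esub> bd N)
        = (\<Oplus>\<^bsub>Hom_grp N M (int (2*m-1))\<^esub>i\<in>{0..<m}.
            (G (2*i) \<star>\<^bsub>N,int (2*(m-i)-1)\<^esub> L (2*(m-i)-1))
              \<ominus>\<^bsub>Hom_grp N M (int (2*m-1))\<^esub> (H (2*(m-i)-1) \<star>\<^bsub>N,int (2*i)\<^esub> G (2*i))) \<and>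
      (bd N \<star>\<^bsub>N,int (2*m+1)\<^esub> L (2*m+1)) \<oplus>\<^bsub>Hom_grp N N (int (2*m))\<^esub> (L (2*m+1) \<star>\<^bsub>N,-1\<^esub> bd N)
        = (\<Oplus>\<^bsub>Hom_grp N N (int (2*m))\<^esub>j\<in>{0..m}.
            F (2*j) \<star>\<^bsub>N,int (2*(m-j))\<^esub> G (2*(m-j)))
          \<ominus>\<^bsub>Hom_grp N N (int (2*m))\<^esub>
          (\<Oplus>\<^bsub>Hom_grp N N (int (2*m))\<^esub>j\<in>{0..<m}.
            L (2*j+1) \<star>\<^bsub>N,int (2*(m-j)-1)\<^esub> L (2*(m-j)-1)))"

definition extends_to_strong ::
    "'a chain_cpx \<Rightarrow> 'b chain_cpx \<Rightarrow> (int \<Rightarrow> 'a \<Rightarrow> 'b) \<Rightarrow> (int \<Rightarrow> 'b \<Rightarrow> 'a) \<Rightarrow>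
     (int \<Rightarrow> 'a \<Rightarrow> 'a) \<Rightarrow> (int \<Rightarrow> 'b \<Rightarrow> 'b) \<Rightarrow> bool" where
  "extends_to_strong M N F G H L \<longleftrightarrow>
     (\<exists>Fs Gs Hs Ls. strong_homotopy_equivalence M N Fs Gs Hs Ls \<and>
        Fs 0 = F \<and> Gs 0 = G \<and> Hs 1 = H \<and> Ls 1 = L)"

end

theory Submission
  imports Defs
begin

text \<open>
  Collect the even members of \<open>F\<close>, \<open>G\<close> and the odd members of \<open>H\<close>, \<open>L\<close> in power series in a variable
  \<open>t\<close> of degree \<open>-2\<close>.  The equations of a strong homotopy equivalence say that the operator
  \<open>D = (d\<^sub>M + tH, -tG; F, -d\<^sub>N - tL)\<close> on the mapping cone of \<open>F\<^sub>0\<close> satisfies \<open>D\<^sup>2 = -t\<close>.  Its constant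
  term is the differential \<open>d\<close> of the cone and its linear term is \<open>s = (H\<^sub>1, -G\<^sub>0; F\<^sub>2, -L\<^sub>1)\<close>, subject
  only to \<open>ds + sd = -1\<close>.  This equation says that \<open>(F\<^sub>0, G\<^sub>0, H\<^sub>1, L\<^sub>1)\<close> is a homotopy equivalence and that
  \<open>F\<^sub>2\<close> bounds \<open>F\<^sub>0H\<^sub>1 - L\<^sub>1F\<^sub>0\<close>.  Given such an \<open>s\<close>, the operator \<open>D = d + \<Sum>\<^sub>m c\<^sub>m t\<^bsup>m+1\<^esup> s\<^bsup>2m+1\<^esup>\<close>
  with the Catalan numbers \<open>c\<^sub>m\<close> squares to \<open>-t\<close>, because \<open>d s\<^bsup>2m+1\<^esup> + s\<^bsup>2m+1\<^esup> d = -s\<^bsup>2m\<^esup>\<close>.  Hence a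
  homotopy equivalence extends to a strong one as soon as \<open>F\<^sub>0H\<^sub>1 - L\<^sub>1F\<^sub>0\<close> is a boundary.
\<close>

section \<open>Abelian groups\<close>

context abelian_group
begin

lemma minus_simps:
  assumes "x \<in> carrier G" "y \<in> carrier G"
  shows "x \<oplus> \<ominus> y = x \<ominus> y" "\<ominus> x \<oplus> y = y \<ominus> x" "x \<ominus> \<ominus> y = x \<oplus> y"
    "\<ominus> (x \<oplus> y) = \<ominus> x \<ominus> y" "\<ominus> (x \<ominus> y) = y \<ominus> x"
    "\<ominus> x = y \<longleftrightarrow> x \<oplus> y = \<zero>" "y = \<ominus> x \<longleftrightarrow> x \<oplus> y = \<zero>"
proof -
  show "\<ominus> x \<oplus> y = y \<ominus> x" "\<ominus> (x \<ominus> y) = y \<ominus> x"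
    using assms by (simp_all add: minus_eq minus_add a_comm)
  show "\<ominus> x = y \<longleftrightarrow> x \<oplus> y = \<zero>" "y = \<ominus> x \<longleftrightarrow> x \<oplus> y = \<zero>"
    using assms by (metis a_comm add.inv_equality r_neg)+
qed (use assms in \<open>simp_all add: minus_eq minus_add r_neg\<close>)

lemma minus_zero_simps:
  assumes "x \<in> carrier G"
  shows "\<zero> \<ominus> x = \<ominus> x" "x \<ominus> \<zero> = x" "x \<ominus> x = \<zero>"
  using assms by (simp_all add: minus_eq r_neg)

lemma minus_eq_iff:
  assumes "x \<in> carrier G" "y \<in> carrier G" "z \<in> carrier G"
  shows "x \<ominus> y = z \<longleftrightarrow> x = z \<oplus> y" "z = x \<ominus> y \<longleftrightarrow> z \<oplus> y = x"
proof -
  have "x \<ominus> y \<oplus> y = x" "z \<oplus> y \<ominus> y = z"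
    using assms by (simp_all add: minus_eq a_assoc l_neg r_neg)
  then show "x \<ominus> y = z \<longleftrightarrow> x = z \<oplus> y" "z = x \<ominus> y \<longleftrightarrow> z \<oplus> y = x" by metis+
qed

lemma minus_add_simps:
  assumes "x \<in> carrier G" "y \<in> carrier G" "z \<in> carrier G"
  shows "x \<oplus> (y \<ominus> z) = x \<oplus> y \<ominus> z" "x \<ominus> y \<oplus> z = x \<oplus> z \<ominus> y"
    "x \<ominus> y \<ominus> z = x \<ominus> (y \<oplus> z)" "x \<ominus> (y \<ominus> z) = x \<oplus> z \<ominus> y"
  using assms by (simp_all add: minus_eq minus_add a_ac r_neg)

text \<open>A normal form: every term becomes one sum minus another, and equations are cleared of
  subtraction, so that identities reduce to associativity and commutativity.\<close>

lemmas abelian_simps = minus_simps minus_zero_simps minus_eq_iff minus_add_simps a_ac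

lemma finsum_minus:
  assumes "finite A" "f \<in> A \<rightarrow> carrier G" "g \<in> A \<rightarrow> carrier G"
  shows "(\<Oplus>i\<in>A. f i \<ominus> g i) = finsum G f A \<ominus> finsum G g A"
  using assms by (induction A) (simp_all add: Pi_iff finsum_closed abelian_simps)

text \<open>Some convolutions in \<open>strong_homotopy_equivalence\<close> are indexed by the inner
  factor, while the square of the perturbation indexes them by the outer one; this reconciles the
  two.\<close>

lemma finsum_atMost_reverse:
  fixes f :: "nat \<Rightarrow> 'a"
  assumes "f \<in> {..m} \<rightarrow> carrier G"
  shows "(\<Oplus>i\<in>{..m}. f (m - i)) = finsum G f {..m}"
proof -
  have "x \<in> (\<lambda>i. m - i) ` {..m}" if "x \<le> m" for x
    using that by (intro image_eqI[of _ _ "m - x"]) auto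
  then have "(\<lambda>i. m - i) ` {..m} = {..m}"
    by auto
  moreover have "inj_on (\<lambda>i. m - i) {..m}"
    by (auto simp: inj_on_def)
  ultimately show ?thesis
    using finsum_reindex[of f "\<lambda>i. m - i" "{..m}"] assms by simp
qed

lemma add_pow_finsum:
  fixes c :: "'i \<Rightarrow> nat"
  assumes "x \<in> carrier G" "finite A"
  shows "(\<Oplus>i\<in>A. [c i] \<cdot> x) = [(\<Sum>i\<in>A. c i)] \<cdot> x"
  using assms(2) by (induction A) (simp_all add: assms(1) add.nat_pow_mult)

end

lemma abelian_group_homI':
  assumes "abelian_group G" "abelian_group H"
    and "\<And>x. x \<in> carrier G \<Longrightarrow> h x \<in> carrier H"
    and "\<And>x y. x \<in> carrier G \<Longrightarrow> y \<in> carrier G \<Longrightarrow> h (x \<oplus>\<^bsub>G\<^esub> y) = h x \<oplus>\<^bsub>H\<^esub> h y"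
  shows "abelian_group_hom G H h"
proof -
  interpret G: abelian_group G by fact
  interpret H: abelian_group H by fact
  show ?thesis
    by (intro abelian_group_homI G.abelian_group_axioms H.abelian_group_axioms group_hom.intro
        group_hom_axioms.intro G.a_group H.a_group) (auto simp: hom_def assms)
qed

lemma (in abelian_group_hom) hom_a_minus:
  assumes "x \<in> carrier G" "y \<in> carrier G"
  shows "h (x \<ominus>\<^bsub>G\<^esub> y) = h x \<ominus>\<^bsub>H\<^esub> h y"
  using assms by (simp add: a_minus_def)

lemma (in abelian_group_hom) hom_finsum:
  assumes "finite A" "f \<in> A \<rightarrow> carrier G"
  shows "h (finsum G f A) = (\<Oplus>\<^bsub>H\<^esub>i\<in>A. h (f i))"
  using assms by (induction A) (simp_all add: Pi_iff)

lemma (in abelian_group_hom) hom_add_pow: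
  fixes c :: nat
  assumes "x \<in> carrier G"
  shows "h ([c] \<cdot>\<^bsub>G\<^esub> x) = [c] \<cdot>\<^bsub>H\<^esub> h x"
  using assms by (induction c) simp_all


section \<open>Graded homomorphisms\<close>

text \<open>Drops the extensionality demanded by \<open>graded_maps\<close>, so that differentials,
  powers and matrix blocks given by plain formulas qualify; \<open>restrict_graded_maps\<close>
  restores it at the end.\<close>

locale graded_hom =
  fixes M :: "'a chain_cpx" and N :: "'b chain_cpx" and k :: int and \<phi> :: "int \<Rightarrow> 'a \<Rightarrow> 'b"
  assumes hom: "abelian_group_hom (grp M n) (grp N (n + k)) (\<phi> n)"
begin

text \<open>The target degree is a separate \<open>m\<close> constrained by an equation, so that the
  simplifier can discharge degree arithmetic as a side condition.\<close>

lemma closed [simp]: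
  assumes "x \<in> carrier (grp M n)" "m = n + k"
  shows "\<phi> n x \<in> carrier (grp N m)"
  using abelian_group_hom.hom_closed[OF hom] assms by simp

lemma add [simp]:
  assumes "x \<in> carrier (grp M n)" "y \<in> carrier (grp M n)"
  shows "\<phi> n (x \<oplus>\<^bsub>grp M n\<^esub> y) = \<phi> n x \<oplus>\<^bsub>grp N (n + k)\<^esub> \<phi> n y"
  using abelian_group_hom.hom_add[OF hom] assms by simp

lemma minus [simp]:
  assumes "x \<in> carrier (grp M n)" "y \<in> carrier (grp M n)"
  shows "\<phi> n (x \<ominus>\<^bsub>grp M n\<^esub> y) = \<phi> n x \<ominus>\<^bsub>grp N (n + k)\<^esub> \<phi> n y"
  using abelian_group_hom.hom_a_minus[OF hom] assms by simp

lemma zero [simp]: "\<phi> n \<zero>\<^bsub>grp M n\<^esub> = \<zero>\<^bsub>grp N (n + k)\<^esub>"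
  using abelian_group_hom.hom_zero[OF hom] .

lemma inv [simp]:
  "x \<in> carrier (grp M n) \<Longrightarrow> \<phi> n (\<ominus>\<^bsub>grp M n\<^esub> x) = \<ominus>\<^bsub>grp N (n + k)\<^esub> \<phi> n x"
  using abelian_group_hom.hom_a_inv[OF hom] .

lemma add_pow:
  "x \<in> carrier (grp M n) \<Longrightarrow> \<phi> n ([c] \<cdot>\<^bsub>grp M n\<^esub> x) = [c] \<cdot>\<^bsub>grp N (n + k)\<^esub> \<phi> n x" for c :: nat
  using abelian_group_hom.hom_add_pow[OF hom] .

end

lemma graded_homI:
  assumes "\<And>n. abelian_group (grp M n)" "\<And>n. abelian_group (grp N n)"
    and "\<And>n x. x \<in> carrier (grp M n) \<Longrightarrow> \<phi> n x \<in> carrier (grp N (n + k))"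
    and "\<And>n x y. x \<in> carrier (grp M n) \<Longrightarrow> y \<in> carrier (grp M n) \<Longrightarrow>
      \<phi> n (x \<oplus>\<^bsub>grp M n\<^esub> y) = \<phi> n x \<oplus>\<^bsub>grp N (n + k)\<^esub> \<phi> n y"
  shows "graded_hom M N k \<phi>"
  by (intro graded_hom.intro abelian_group_homI' assms)

sublocale chain_complex \<subseteq> grp: abelian_group "grp M n" for n
  using abelian_group_hom.axioms(1)[OF bd_hom] .

sublocale chain_complex \<subseteq> bd: graded_hom M M "-1" "bd M"
  by (rule graded_hom.intro) (use bd_hom in simp)

section \<open>The abelian group of graded maps and its pointwise operations\<close>

context
  fixes M :: "'a chain_cpx" and N :: "'b chain_cpx"
  assumes M: "chain_complex M" and N: "chain_complex N"
begin

interpretation M: chain_complex M by (fact M)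
interpretation N: chain_complex N by (fact N)

lemma graded_maps_hom:
  assumes "\<phi> \<in> graded_maps M N k"
  shows "graded_hom M N k \<phi>"
  using assms
  by (intro graded_homI) (auto simp: graded_maps_def hom_def M.grp.abelian_group_axioms N.grp.abelian_group_axioms)

lemma restrict_graded_maps:
  assumes "graded_hom M N k \<phi>"
  shows "(\<lambda>n. \<lambda>x\<in>carrier (grp M n). \<phi> n x) \<in> graded_maps M N k"
proof -
  interpret graded_hom M N k \<phi> by fact
  show ?thesis by (auto simp: graded_maps_def hom_def)
qed

lemma graded_maps_eqI:
  assumes "\<phi> \<in> graded_maps M N k" "\<psi> \<in> graded_maps M N k"
    and "\<And>n x. x \<in> carrier (grp M n) \<Longrightarrow> \<phi> n x = \<psi> n x"
  shows "\<phi> = \<psi>"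
proof
  fix n
  show "\<phi> n = \<psi> n"
    using assms by (intro extensionalityI[of _ "carrier (grp M n)"]) (auto simp: graded_maps_def)
qed

lemma Hom_grp_carrier [simp]: "carrier (Hom_grp M N k) = graded_maps M N k"
  by (simp add: Hom_grp_def)

lemma Hom_grp_add_apply [simp]:
  "x \<in> carrier (grp M n) \<Longrightarrow> (\<phi> \<oplus>\<^bsub>Hom_grp M N k\<^esub> \<psi>) n x = \<phi> n x \<oplus>\<^bsub>grp N (n + k)\<^esub> \<psi> n x"
  by (simp add: Hom_grp_def)

lemma abelian_group_Hom_grp: "abelian_group (Hom_grp M N k)"
proof (rule abelian_groupI)
  show zero: "\<zero>\<^bsub>Hom_grp M N k\<^esub> \<in> carrier (Hom_grp M N k)"
    by (auto simp: Hom_grp_def graded_maps_def hom_def)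
  fix \<phi> assume phi: "\<phi> \<in> carrier (Hom_grp M N k)"
  interpret p: graded_hom M N k \<phi> using phi by (simp add: graded_maps_hom)
  have "(\<lambda>n. \<lambda>x\<in>carrier (grp M n). \<ominus>\<^bsub>grp N (n + k)\<^esub> \<phi> n x) \<in> graded_maps M N k"
    by (auto simp: graded_maps_def hom_def N.grp.minus_add)
  moreover from this have "(\<lambda>n. \<lambda>x\<in>carrier (grp M n). \<ominus>\<^bsub>grp N (n + k)\<^esub> \<phi> n x) \<oplus>\<^bsub>Hom_grp M N k\<^esub> \<phi> = \<zero>\<^bsub>Hom_grp M N k\<^esub>"
    by (auto simp: Hom_grp_def N.grp.l_neg intro!: ext)
  ultimately show "\<exists>\<psi>\<in>carrier (Hom_grp M N k). \<psi> \<oplus>\<^bsub>Hom_grp M N k\<^esub> \<phi> = \<zero>\<^bsub>Hom_grp M N k\<^esub>"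
    by auto
  show "\<zero>\<^bsub>Hom_grp M N k\<^esub> \<oplus>\<^bsub>Hom_grp M N k\<^esub> \<phi> = \<phi>"
    using phi by (auto simp: Hom_grp_def graded_maps_def extensional_def intro!: ext)
  fix \<psi> assume psi: "\<psi> \<in> carrier (Hom_grp M N k)"
  interpret q: graded_hom M N k \<psi> using psi by (simp add: graded_maps_hom)
  show "\<phi> \<oplus>\<^bsub>Hom_grp M N k\<^esub> \<psi> \<in> carrier (Hom_grp M N k)"
    by (auto simp: Hom_grp_def graded_maps_def hom_def N.grp.a_ac)
  show "\<phi> \<oplus>\<^bsub>Hom_grp M N k\<^esub> \<psi> = \<psi> \<oplus>\<^bsub>Hom_grp M N k\<^esub> \<phi>"
    by (auto simp: Hom_grp_def N.grp.a_ac intro!: ext)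
  fix \<chi> assume chi: "\<chi> \<in> carrier (Hom_grp M N k)"
  interpret r: graded_hom M N k \<chi> using chi by (simp add: graded_maps_hom)
  show "\<phi> \<oplus>\<^bsub>Hom_grp M N k\<^esub> \<psi> \<oplus>\<^bsub>Hom_grp M N k\<^esub> \<chi> = \<phi> \<oplus>\<^bsub>Hom_grp M N k\<^esub> (\<psi> \<oplus>\<^bsub>Hom_grp M N k\<^esub> \<chi>)"
    by (auto simp: Hom_grp_def N.grp.a_ac intro!: ext)
qed

lemma graded_maps_add [simp]:
  "\<phi> \<in> graded_maps M N k \<Longrightarrow> \<psi> \<in> graded_maps M N k \<Longrightarrow> \<phi> \<oplus>\<^bsub>Hom_grp M N k\<^esub> \<psi> \<in> graded_maps M N k"
  using abelian_groupE(1)[OF abelian_group_Hom_grp] by simp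

lemma graded_maps_minus [simp]:
  "\<phi> \<in> graded_maps M N k \<Longrightarrow> \<psi> \<in> graded_maps M N k \<Longrightarrow> \<phi> \<ominus>\<^bsub>Hom_grp M N k\<^esub> \<psi> \<in> graded_maps M N k"
  using abelian_group.minus_closed[OF abelian_group_Hom_grp] by simp

text \<open>Evaluation being a homomorphism, differences and finite sums in \<open>Hom_grp\<close>
  are computed pointwise without unfolding them.\<close>

lemma Hom_grp_hom_apply:
  assumes "x \<in> carrier (grp M n)"
  shows "abelian_group_hom (Hom_grp M N k) (grp N (n + k)) (\<lambda>\<phi>. \<phi> n x)"
  using assms
  by (intro abelian_group_homI' abelian_group_Hom_grp N.grp.abelian_group_axioms)
    (auto simp: graded_hom.closed[OF graded_maps_hom])

lemma Hom_grp_minus_apply [simp]: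
  assumes "\<phi> \<in> graded_maps M N k" "\<psi> \<in> graded_maps M N k" "x \<in> carrier (grp M n)"
  shows "(\<phi> \<ominus>\<^bsub>Hom_grp M N k\<^esub> \<psi>) n x = \<phi> n x \<ominus>\<^bsub>grp N (n + k)\<^esub> \<psi> n x"
  using abelian_group_hom.hom_a_minus[OF Hom_grp_hom_apply] assms by simp

lemma graded_maps_finsum [simp]:
  assumes "\<And>i. i \<in> A \<Longrightarrow> f i \<in> graded_maps M N k"
  shows "finsum (Hom_grp M N k) f A \<in> graded_maps M N k"
  using abelian_monoid.finsum_closed[OF abelian_group.axioms(1)[OF abelian_group_Hom_grp], of f A k] assms
  by (simp add: Pi_iff)

lemma Hom_grp_finsum_apply [simp]:
  assumes "\<And>i. i \<in> A \<Longrightarrow> f i \<in> graded_maps M N k" "finite A" "x \<in> carrier (grp M n)"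
  shows "finsum (Hom_grp M N k) f A n x = (\<Oplus>\<^bsub>grp N (n + k)\<^esub>i\<in>A. f i n x)"
  using abelian_group_hom.hom_finsum[OF Hom_grp_hom_apply, of x n A f k] assms by (simp add: Pi_iff)

end

section \<open>Composites and identities of graded maps\<close>

lemma graded_comp_apply [simp]:
  "x \<in> carrier (grp M n) \<Longrightarrow> (\<psi> \<star>\<^bsub>M,k\<^esub> \<phi>) n x = \<psi> (n + k) (\<phi> n x)"
  by (simp add: graded_comp_def)

lemma graded_comp_closed:
  assumes "graded_hom M N k \<phi>" "graded_hom N P l \<psi>" "m = k + l"
  shows "\<psi> \<star>\<^bsub>M,k\<^esub> \<phi> \<in> graded_maps M P m"
proof -
  interpret p: graded_hom M N k \<phi> by fact
  interpret q: graded_hom N P l \<psi> by fact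
  have "x \<oplus>\<^bsub>grp M n\<^esub> y \<in> carrier (grp M n)"
    if "x \<in> carrier (grp M n)" "y \<in> carrier (grp M n)" for n x y
    using that p.hom[of n] by (auto intro: abelian_groupE(1) abelian_group_hom.axioms)
  then show ?thesis using assms(3)
    by (auto simp: graded_maps_def hom_def graded_comp_def add.assoc)
qed

lemma id_map_apply [simp]: "x \<in> carrier (grp M n) \<Longrightarrow> id_map M n x = x"
  by (simp add: id_map_def)

lemma id_map_closed:
  assumes "chain_complex M"
  shows "id_map M \<in> graded_maps M M 0"
proof -
  interpret chain_complex M by fact
  show ?thesis by (auto simp: graded_maps_def hom_def id_map_def)
qed

section \<open>Perturbing a contractible complex\<close>

text \<open>Defined by the convolution recurrence because squaring the perturbation produces exactly
  these convolutions.\<close>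

fun catalan :: "nat \<Rightarrow> nat" where
  "catalan 0 = 1"
| "catalan (Suc n) = (\<Sum>i\<le>n. catalan i * catalan (n - i))"

text \<open>Here \<open>s\<close> is the negative of a contracting homotopy; this sign makes the
  perturbed differential square to -t. The powers of \<open>s\<close> need not vanish.\<close>

locale contraction = chain_complex C + s: graded_hom C C 1 s
  for C :: "'c chain_cpx" and s :: "int \<Rightarrow> 'c \<Rightarrow> 'c" +
  assumes contraction: "x \<in> carrier (grp C n) \<Longrightarrow>
    bd C (n + 1) (s n x) \<oplus>\<^bsub>grp C n\<^esub> s (n - 1) (bd C n x) = \<ominus>\<^bsub>grp C n\<^esub> x"
begin

text \<open>The power s^j. The degree has to be carried along, since each factor acts through the
  component of \<open>s\<close> at the degree reached so far.\<close>

primrec pw :: "nat \<Rightarrow> int \<Rightarrow> 'c \<Rightarrow> 'c" where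
  "pw 0 n x = x"
| "pw (Suc j) n x = s (n + int j) (pw j n x)"

lemma pw_closed:
  "x \<in> carrier (grp C n) \<Longrightarrow> pw j n x \<in> carrier (grp C (n + int j))"
  by (induction j) (simp_all add: add.assoc)

lemma pw_graded_hom: "graded_hom C C (int j) (pw j)"
proof (rule graded_homI)
  fix n x y assume xy: "x \<in> carrier (grp C n)" "y \<in> carrier (grp C n)"
  show "pw j n (x \<oplus>\<^bsub>grp C n\<^esub> y) = pw j n x \<oplus>\<^bsub>grp C (n + int j)\<^esub> pw j n y"
    using xy by (induction j) (simp_all add: pw_closed add_ac)
qed (simp_all add: pw_closed grp.abelian_group_axioms)

sublocale pw: graded_hom C C "int j" "pw j" for j
  by (rule pw_graded_hom)

lemma pw_add: "pw i (n + int j) (pw j n x) = pw (i + j) n x"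
  by (induction i) (simp_all add: add_ac)

lemma bd_s:
  assumes "x \<in> carrier (grp C n)"
  shows "bd C (n + 1) (s n x) = \<ominus>\<^bsub>grp C n\<^esub> x \<ominus>\<^bsub>grp C n\<^esub> s (n - 1) (bd C n x)"
proof -
  have "bd C (n + 1) (s n x) = bd C (n + 1) (s n x) \<oplus>\<^bsub>grp C n\<^esub> s (n - 1) (bd C n x) \<ominus>\<^bsub>grp C n\<^esub> s (n - 1) (bd C n x)"
    using assms by (simp add: grp.minus_eq grp.a_assoc grp.r_neg)
  then show ?thesis using contraction[OF assms] by simp
qed

text \<open>Two applications of ds = -1 - sd cancel: d s^2 = -s - s(-1 - sd) = s^2 d. So d commutes
  with even powers of s, and one further factor gives the odd powers.\<close>

lemma bd_pw:
  assumes "x \<in> carrier (grp C n)"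
  shows bd_pw_even: "bd C (n + 2 * int j) (pw (2 * j) n x) = pw (2 * j) (n - 1) (bd C n x)" (is "?even j")
    and bd_pw_odd: "bd C (n + 2 * int j + 1) (pw (Suc (2 * j)) n x) =
      \<ominus>\<^bsub>grp C (n + 2 * int j)\<^esub> pw (2 * j) n x
      \<ominus>\<^bsub>grp C (n + 2 * int j)\<^esub> pw (Suc (2 * j)) (n - 1) (bd C n x)" (is "?odd j")
proof -
  \<comment> \<open>The induction alternates: the odd statement follows from the even one at the
    same \<open>j\<close>, and the even one at \<open>Suc j\<close> from the odd one at
    \<open>j\<close>.\<close>
  have odd: "?odd j" if "?even j" for j
    using that assms bd_s[of "pw (2 * j) n x" "n + 2 * int j"] pw_closed[OF assms, of "2 * j"]
    by (simp add: algebra_simps)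
  have "?even j" for j
  proof (induction j)
    case (Suc j)
    let ?m = "n + 2 * int j + 1"
    let ?z = "pw (Suc (2 * j)) n x" and ?w = "pw (Suc (2 * j)) (n - 1) (bd C n x)"
    have car: "pw (2 * j) n x \<in> carrier (grp C (?m - 1))" "?z \<in> carrier (grp C ?m)"
      "?w \<in> carrier (grp C (?m - 1))" "s (?m - 1) ?w \<in> carrier (grp C ?m)"
      using assms by simp_all
    have "bd C (?m + 1) (s ?m ?z) = \<ominus>\<^bsub>grp C ?m\<^esub> ?z \<ominus>\<^bsub>grp C ?m\<^esub> s (?m - 1) (bd C ?m ?z)"
      using car by (intro bd_s) 
    also have "bd C ?m ?z = \<ominus>\<^bsub>grp C (?m - 1)\<^esub> pw (2 * j) n x \<ominus>\<^bsub>grp C (?m - 1)\<^esub> ?w"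
      using odd[OF Suc] by simp
    also have "s (?m - 1) \<dots> = \<ominus>\<^bsub>grp C ?m\<^esub> ?z \<ominus>\<^bsub>grp C ?m\<^esub> s (?m - 1) ?w"
      using car by simp
    \<comment> \<open>The two copies of \<open>?z\<close> cancel, which is why s^2 commutes with
      d.\<close>
    also have "\<ominus>\<^bsub>grp C ?m\<^esub> ?z \<ominus>\<^bsub>grp C ?m\<^esub> (\<ominus>\<^bsub>grp C ?m\<^esub> ?z \<ominus>\<^bsub>grp C ?m\<^esub> s (?m - 1) ?w) = s (?m - 1) ?w"
      using car by (simp add: grp.minus_eq grp.minus_add grp.l_neg flip: grp.a_assoc del: pw.simps)
    finally show ?case by (simp add: add_ac)
  qed simp
  then show "?even j" "?odd j" using odd by blast+
qed

text \<open>The coefficients of the series \<open>f = t + s\<^sup>2f\<^sup>2\<close>, for which \<open>d + s f\<close> squares to \<open>-t\<close>.\<close>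
definition pert :: "nat \<Rightarrow> int \<Rightarrow> 'c \<Rightarrow> 'c" where
  "pert m n x = [catalan m] \<cdot>\<^bsub>grp C (n + 2 * int m + 1)\<^esub> pw (Suc (2 * m)) n x"

lemma pert_0: "x \<in> carrier (grp C n) \<Longrightarrow> pert 0 n x = s n x"
  by (simp add: pert_def)

lemma pert_graded_hom: "graded_hom C C (2 * int m + 1) (pert m)"
  by (rule graded_homI)
    (simp_all add: pert_def grp.abelian_group_axioms grp.add.nat_pow_distrib add_ac del: pw.simps)

text \<open>This is the coefficient of t^(m+2) in D^2 = -t, as \<open>pert i\<close> is the
  coefficient of t^(i+1) in D. By \<open>bd_pw_odd\<close> the two terms with the differential add
  up to -c s^(2m+2), where c is \<open>catalan (Suc m)\<close>; the convolution is the same multiple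
  of s^(2m+2) with positive sign.\<close>

lemma pert_master:
  assumes x: "x \<in> carrier (grp C n)"
  shows "bd C (n + 2 * int m + 3) (pert (Suc m) n x)
      \<oplus>\<^bsub>grp C (n + 2 * int m + 2)\<^esub> pert (Suc m) (n - 1) (bd C n x)
      \<oplus>\<^bsub>grp C (n + 2 * int m + 2)\<^esub>
        (\<Oplus>\<^bsub>grp C (n + 2 * int m + 2)\<^esub>i\<in>{..m}. pert i (n + 2 * int (m - i) + 1) (pert (m - i) n x))
    = \<zero>\<^bsub>grp C (n + 2 * int m + 2)\<^esub>"
proof -
  let ?K = "grp C (n + 2 * int m + 2)" and ?p = "pw (2 * Suc m) n x" and ?c = "catalan (Suc m)"
  let ?w = "pw (Suc (2 * Suc m)) (n - 1) (bd C n x)"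
  have car: "?p \<in> carrier ?K" "?w \<in> carrier ?K" "pw (Suc (2 * Suc m)) n x \<in> carrier (grp C (n + 2 * int m + 3))"
    using x by (simp_all add: pw_closed del: pw.simps)
  have "bd C (n + 2 * int m + 3) (pert (Suc m) n x) = [?c] \<cdot>\<^bsub>?K\<^esub> bd C (n + 2 * int m + 3) (pw (Suc (2 * Suc m)) n x)"
    using car bd.add_pow[of _ "n + 2 * int m + 3"] by (simp add: pert_def add_ac del: pw.simps catalan.simps)
  also have "bd C (n + 2 * int m + 3) (pw (Suc (2 * Suc m)) n x) = \<ominus>\<^bsub>?K\<^esub> ?p \<ominus>\<^bsub>?K\<^esub> ?w"
    using bd_pw_odd[OF x, of "Suc m"] by (simp add: add_ac del: pw.simps)
  also have "[?c] \<cdot>\<^bsub>?K\<^esub> \<dots> = \<ominus>\<^bsub>?K\<^esub> ([?c] \<cdot>\<^bsub>?K\<^esub> ?p) \<ominus>\<^bsub>?K\<^esub> ([?c] \<cdot>\<^bsub>?K\<^esub> ?w)"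
    using car by (simp add: grp.minus_eq grp.add.nat_pow_distrib grp.add.nat_pow_inv del: pw.simps catalan.simps)
  finally have 1: "bd C (n + 2 * int m + 3) (pert (Suc m) n x) = \<dots>" .
  have 2: "pert (Suc m) (n - 1) (bd C n x) = [?c] \<cdot>\<^bsub>?K\<^esub> ?w"
    by (simp add: pert_def add_ac del: pw.simps catalan.simps)
  \<comment> \<open>Integer coefficients pass through the additive map \<open>pw\<close>, and the
    exponents 2i+1 and 2(m-i)+1 add up to 2m+2 for every \<open>i\<close>.\<close>
  have "pert i (n + 2 * int (m - i) + 1) (pert (m - i) n x) = [(catalan i * catalan (m - i))] \<cdot>\<^bsub>?K\<^esub> ?p"
    if "i \<le> m" for i
  proof -
    let ?l = "n + 2 * int (m - i) + 1"
    have deg: "?l + 2 * int i + 1 = n + 2 * int m + 2" using that by (simp add: of_nat_diff)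
    have l: "?l = n + int (Suc (2 * (m - i)))" by simp
    have car': "pw (Suc (2 * (m - i))) n x \<in> carrier (grp C ?l)"
      using x by (simp add: pw_closed del: pw.simps)
    have "pw (Suc (2 * i)) ?l (pw (Suc (2 * (m - i))) n x) = ?p"
      unfolding l pw_add using that by (simp add: algebra_simps del: pw.simps)
    moreover have "pw (Suc (2 * i)) ?l ([(catalan (m - i))] \<cdot>\<^bsub>grp C ?l\<^esub> pw (Suc (2 * (m - i))) n x) =
        [(catalan (m - i))] \<cdot>\<^bsub>?K\<^esub> pw (Suc (2 * i)) ?l (pw (Suc (2 * (m - i))) n x)"
      using pw.add_pow[OF car', of "Suc (2 * i)"] deg by (simp add: add_ac del: pw.simps)
    ultimately show ?thesis
      using car deg by (simp add: pert_def grp.add.nat_pow_pow mult.commute add_ac del: pw.simps)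
  qed
  then have "(\<Oplus>\<^bsub>?K\<^esub>i\<in>{..m}. pert i (n + 2 * int (m - i) + 1) (pert (m - i) n x)) =
      (\<Oplus>\<^bsub>?K\<^esub>i\<in>{..m}. [(catalan i * catalan (m - i))] \<cdot>\<^bsub>?K\<^esub> ?p)"
    using car by (intro grp.finsum_cong') (auto simp del: pw.simps)
  \<comment> \<open>All summands are multiples of the same element, and their coefficients sum to
    \<open>catalan (Suc m)\<close> by its recurrence.\<close>
  also have "\<dots> = [?c] \<cdot>\<^bsub>?K\<^esub> ?p"
    using car by (simp add: grp.add_pow_finsum del: pw.simps)
  finally show ?thesis
    unfolding 1 2 using car
    by (simp add: grp.minus_eq grp.a_assoc grp.l_neg grp.r_neg grp.a_lcomm del: pw.simps catalan.simps)
qed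

end

section \<open>The mapping cone\<close>

text \<open>The usual cone shifted by one: N_(n+1) sits in degree n, so that a degree 0 map from M
  to N acts with degree -1 and can be an entry of the differential.\<close>

definition cone_grp :: "'a chain_cpx \<Rightarrow> 'b chain_cpx \<Rightarrow> int \<Rightarrow> ('a \<times> 'b) ring" where
  "cone_grp M N n =
    \<lparr>carrier = carrier (grp M n) \<times> carrier (grp N (n + 1)), mult = undefined, one = undefined,
     zero = (\<zero>\<^bsub>grp M n\<^esub>, \<zero>\<^bsub>grp N (n + 1)\<^esub>),
     add = (\<lambda>p q. (fst p \<oplus>\<^bsub>grp M n\<^esub> fst q, snd p \<oplus>\<^bsub>grp N (n + 1)\<^esub> snd q))\<rparr>"

definition cone :: "'a chain_cpx \<Rightarrow> 'b chain_cpx \<Rightarrow> (int \<Rightarrow> 'a \<Rightarrow> 'b) \<Rightarrow> ('a \<times> 'b) chain_cpx" where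
  "cone M N F =
    \<lparr>grp = cone_grp M N,
     bd = (\<lambda>n p. (bd M n (fst p), F n (fst p) \<ominus>\<^bsub>grp N n\<^esub> bd N (n + 1) (snd p)))\<rparr>"

text \<open>\<open>K\<close> is a filling of the obstruction: FH - LF is its boundary in the Hom
  complex. It becomes the member F_2 of the strong homotopy equivalence.\<close>

locale filled_homotopy_equivalence =
  M: chain_complex M + N: chain_complex N +
  F: graded_hom M N 0 F + G: graded_hom N M 0 G + H: graded_hom M M 1 H + L: graded_hom N N 1 L +
  K: graded_hom M N 2 K
  for M :: "'a chain_cpx" and N :: "'b chain_cpx" and F G H L K +
  assumes F_bd: "x \<in> carrier (grp M n) \<Longrightarrow> F (n - 1) (bd M n x) = bd N n (F n x)"
    and G_bd: "y \<in> carrier (grp N n) \<Longrightarrow> G (n - 1) (bd N n y) = bd M n (G n y)"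
    and H_bd: "x \<in> carrier (grp M n) \<Longrightarrow>
      bd M (n + 1) (H n x) \<oplus>\<^bsub>grp M n\<^esub> H (n - 1) (bd M n x) = G n (F n x) \<ominus>\<^bsub>grp M n\<^esub> x"
    and L_bd: "y \<in> carrier (grp N n) \<Longrightarrow>
      bd N (n + 1) (L n y) \<oplus>\<^bsub>grp N n\<^esub> L (n - 1) (bd N n y) = F n (G n y) \<ominus>\<^bsub>grp N n\<^esub> y"
    and K_bd: "x \<in> carrier (grp M n) \<Longrightarrow>
      bd N (n + 2) (K n x) \<ominus>\<^bsub>grp N (n + 1)\<^esub> K (n - 1) (bd M n x)
        = F (n + 1) (H n x) \<ominus>\<^bsub>grp N (n + 1)\<^esub> L n (F n x)"
begin

abbreviation C where "C \<equiv> cone M N F"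

lemma cone_simps [simp]:
  "carrier (grp C n) = carrier (grp M n) \<times> carrier (grp N (n + 1))"
  "\<zero>\<^bsub>grp C n\<^esub> = (\<zero>\<^bsub>grp M n\<^esub>, \<zero>\<^bsub>grp N (n + 1)\<^esub>)"
  "(x, y) \<oplus>\<^bsub>grp C n\<^esub> (x', y') = (x \<oplus>\<^bsub>grp M n\<^esub> x', y \<oplus>\<^bsub>grp N (n + 1)\<^esub> y')"
  "bd C n (x, y) = (bd M n x, F n x \<ominus>\<^bsub>grp N n\<^esub> bd N (n + 1) y)"
  by (simp_all add: cone_def cone_grp_def)

lemma abelian_group_cone: "abelian_group (grp C n)"
proof (rule abelian_groupI)
  fix p assume "p \<in> carrier (grp C n)"
  then show "\<exists>q\<in>carrier (grp C n). q \<oplus>\<^bsub>grp C n\<^esub> p = \<zero>\<^bsub>grp C n\<^esub>"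
    by (intro bexI[of _ "(\<ominus>\<^bsub>grp M n\<^esub> fst p, \<ominus>\<^bsub>grp N (n + 1)\<^esub> snd p)"])
      (auto simp: M.grp.l_neg N.grp.l_neg)
qed (auto simp: M.grp.a_ac N.grp.a_ac)

sublocale cone: chain_complex C
proof (rule chain_complex.intro)
  fix n
  show "abelian_group_hom (grp C n) (grp C (n - 1)) (bd C n)"
    by (intro abelian_group_homI' abelian_group_cone)
      (auto simp: N.grp.minus_eq N.grp.minus_add N.grp.a_ac)
  \<comment> \<open>The entry of d^2 from M to N is Fd - dF, which vanishes because \<open>F\<close>
    is a chain map; the sign of d_N in the cone serves this purpose.\<close>
  show "bd C (n - 1) (bd C n p) = \<zero>\<^bsub>grp C (n - 2)\<^esub>" if "p \<in> carrier (grp C n)" for p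
    using that N.bd_bd[of _ "n + 1"]
    by (auto simp: M.bd_bd F_bd N.grp.abelian_simps)
qed

lemma cone_inv [simp]:
  "x \<in> carrier (grp M n) \<Longrightarrow> y \<in> carrier (grp N (n + 1)) \<Longrightarrow>
    \<ominus>\<^bsub>grp C n\<^esub> (x, y) = (\<ominus>\<^bsub>grp M n\<^esub> x, \<ominus>\<^bsub>grp N (n + 1)\<^esub> y)"
  by (rule cone.grp.minus_equality) (simp_all add: M.grp.l_neg N.grp.l_neg)

lemma cone_finsum:
  assumes "finite A" "\<And>i. i \<in> A \<Longrightarrow> f i = (a i, b i)" "k = n + 1"
    and "a \<in> A \<rightarrow> carrier (grp M n)" "b \<in> A \<rightarrow> carrier (grp N k)"
  shows "finsum (grp C n) f A = (finsum (grp M n) a A, finsum (grp N k) b A)"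
proof -
  have "finsum (grp C n) f A = (\<Oplus>\<^bsub>grp C n\<^esub>i\<in>A. (a i, b i))"
    using assms by (intro cone.grp.finsum_cong') auto
  also have "\<dots> = (finsum (grp M n) a A, finsum (grp N k) b A)"
    using assms(1,4,5) unfolding assms(3) by (induction A) (auto simp: Pi_iff)
  finally show ?thesis .
qed

text \<open>The linear term s of the perturbed differential, with \<open>K\<close> in the place of
  F_2.\<close>

definition contr :: "int \<Rightarrow> 'a \<times> 'b \<Rightarrow> 'a \<times> 'b" where
  "contr n p = (H n (fst p) \<ominus>\<^bsub>grp M (n + 1)\<^esub> G (n + 1) (snd p),
    K n (fst p) \<ominus>\<^bsub>grp N (n + 2)\<^esub> L (n + 1) (snd p))"

lemma contr_apply [simp]:
  "contr n (x, y) = (H n x \<ominus>\<^bsub>grp M (n + 1)\<^esub> G (n + 1) y, K n x \<ominus>\<^bsub>grp N (n + 2)\<^esub> L (n + 1) y)"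
  by (simp add: contr_def)

lemma contr_graded_hom: "graded_hom C C 1 contr"
  by (rule graded_homI)
    (auto simp: abelian_group_cone M.grp.minus_eq N.grp.minus_eq M.grp.minus_add N.grp.minus_add
      M.grp.a_ac N.grp.a_ac add_ac)

text \<open>The component \<open>M \<rightarrow> N\<close> of this identity is \<open>K_bd\<close>.\<close>
sublocale contraction C contr
proof (intro contraction.intro contr_graded_hom cone.chain_complex_axioms contraction_axioms.intro)
  fix p n assume "p \<in> carrier (grp C n)"
  then obtain x y where p: "p = (x, y)" and xy: "x \<in> carrier (grp M n)" "y \<in> carrier (grp N (n + 1))"
    by auto
  have G: "G n (bd N (n + 1) y) = bd M (n + 1) (G (n + 1) y)"
    using G_bd[OF xy(2)] by simp
  let ?A = "grp M n" and ?B = "grp N (n + 1)"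
  \<comment> \<open>The M component: the terms in \<open>y\<close> cancel because \<open>G\<close>
    is a chain map, and those in \<open>x\<close> are dH + Hd - GF = -1.\<close>
  have "bd M (n + 1) (H n x \<ominus>\<^bsub>grp M (n + 1)\<^esub> G (n + 1) y)
      \<oplus>\<^bsub>?A\<^esub> (H (n - 1) (bd M n x) \<ominus>\<^bsub>?A\<^esub> G n (F n x \<ominus>\<^bsub>grp N n\<^esub> bd N (n + 1) y))
    = bd M (n + 1) (H n x) \<oplus>\<^bsub>?A\<^esub> H (n - 1) (bd M n x) \<ominus>\<^bsub>?A\<^esub> G n (F n x)"
    using xy G by (simp add: M.grp.abelian_simps)
  also have "\<dots> = \<ominus>\<^bsub>?A\<^esub> x"
    using xy by (simp add: H_bd) (simp add: M.grp.abelian_simps)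
  finally have 1: "bd M (n + 1) (H n x \<ominus>\<^bsub>grp M (n + 1)\<^esub> G (n + 1) y)
      \<oplus>\<^bsub>?A\<^esub> (H (n - 1) (bd M n x) \<ominus>\<^bsub>?A\<^esub> G n (F n x \<ominus>\<^bsub>grp N n\<^esub> bd N (n + 1) y)) = \<ominus>\<^bsub>?A\<^esub> x" .
  have K: "bd N (n + 2) (K n x) = F (n + 1) (H n x) \<ominus>\<^bsub>?B\<^esub> L n (F n x) \<oplus>\<^bsub>?B\<^esub> K (n - 1) (bd M n x)"
    using K_bd[OF xy(1)] xy by (simp add: N.grp.abelian_simps)
  have L: "F (n + 1) (G (n + 1) y) = bd N (n + 2) (L (n + 1) y) \<oplus>\<^bsub>?B\<^esub> L n (bd N (n + 1) y) \<oplus>\<^bsub>?B\<^esub> y"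
    using L_bd[OF xy(2)] xy by (simp add: N.grp.abelian_simps add_ac)
  \<comment> \<open>The N component: the terms in \<open>x\<close> cancel because \<open>K\<close>
    fills the obstruction, and those in \<open>y\<close> are dL + Ld - FG = -1.\<close>
  have 2: "F (n + 1) (H n x \<ominus>\<^bsub>grp M (n + 1)\<^esub> G (n + 1) y)
      \<ominus>\<^bsub>?B\<^esub> bd N (n + 2) (K n x \<ominus>\<^bsub>grp N (n + 2)\<^esub> L (n + 1) y)
      \<oplus>\<^bsub>?B\<^esub> (K (n - 1) (bd M n x) \<ominus>\<^bsub>?B\<^esub> L n (F n x \<ominus>\<^bsub>grp N n\<^esub> bd N (n + 1) y)) = \<ominus>\<^bsub>?B\<^esub> y"
    using xy by (simp add: K L) (simp add: N.grp.abelian_simps add_ac)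
  show "bd C (n + 1) (contr n p) \<oplus>\<^bsub>grp C n\<^esub> contr (n - 1) (bd C n p) = \<ominus>\<^bsub>grp C n\<^esub> p"
    using xy 1 2 unfolding p by (simp add: add_ac)
qed

end

section \<open>Components of the perturbation\<close>

context filled_homotopy_equivalence
begin

text \<open>These families are indexed by \<open>m\<close>, not by the degree \<open>2m\<close> or \<open>2m + 1\<close> of their members.\<close>

definition strong_H :: "nat \<Rightarrow> int \<Rightarrow> 'a \<Rightarrow> 'a" where
  "strong_H m n x = fst (pert m n (x, \<zero>\<^bsub>grp N (n + 1)\<^esub>))"

text \<open>The index is shifted: F_0 is already an entry of the constant term d, so the block of
  \<open>pert m\<close>, the coefficient of t^(m+1), is F_(2m+2).\<close>

fun strong_F :: "nat \<Rightarrow> int \<Rightarrow> 'a \<Rightarrow> 'b" where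
  "strong_F 0 n x = F n x"
| "strong_F (Suc m) n x = snd (pert m n (x, \<zero>\<^bsub>grp N (n + 1)\<^esub>))"

text \<open>The second column of the matrix carries the signs of -tG and -tL, undone here and in
  \<open>strong_L\<close>. An element of N_n has degree n-1 in the cone, hence the argument
  \<open>n - 1\<close>.\<close>

definition strong_G :: "nat \<Rightarrow> int \<Rightarrow> 'b \<Rightarrow> 'a" where
  "strong_G m n y = \<ominus>\<^bsub>grp M (n + 2 * int m)\<^esub> fst (pert m (n - 1) (\<zero>\<^bsub>grp M (n - 1)\<^esub>, y))"

definition strong_L :: "nat \<Rightarrow> int \<Rightarrow> 'b \<Rightarrow> 'b" where
  "strong_L m n y = \<ominus>\<^bsub>grp N (n + 2 * int m + 1)\<^esub> snd (pert m (n - 1) (\<zero>\<^bsub>grp M (n - 1)\<^esub>, y))"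

sublocale pert: graded_hom C C "2 * int m + 1" "pert m" for m
  by (rule pert_graded_hom)

lemma pert_fst_closed [simp]:
  "x \<in> carrier (grp M n) \<Longrightarrow> y \<in> carrier (grp N (n + 1)) \<Longrightarrow> k = n + 2 * int m + 1 \<Longrightarrow>
    fst (pert m n (x, y)) \<in> carrier (grp M k)"
  and pert_snd_closed [simp]:
  "x \<in> carrier (grp M n) \<Longrightarrow> y \<in> carrier (grp N (n + 1)) \<Longrightarrow> k = n + 2 * int m + 2 \<Longrightarrow>
    snd (pert m n (x, y)) \<in> carrier (grp N k)"
  using pert.closed[of "(x, y)" n "n + 2 * int m + 1" m] by (auto simp: mem_Times_iff add_ac)

lemma cone_add: "p \<oplus>\<^bsub>grp C n\<^esub> q = (fst p \<oplus>\<^bsub>grp M n\<^esub> fst q, snd p \<oplus>\<^bsub>grp N (n + 1)\<^esub> snd q)"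
  by (cases p; cases q) simp

lemma pert_add:
  assumes "x \<in> carrier (grp M n)" "x' \<in> carrier (grp M n)"
    and "y \<in> carrier (grp N (n + 1))" "y' \<in> carrier (grp N (n + 1))"
  shows "pert m n (x \<oplus>\<^bsub>grp M n\<^esub> x', y \<oplus>\<^bsub>grp N (n + 1)\<^esub> y') =
    (fst (pert m n (x, y)) \<oplus>\<^bsub>grp M (n + 2 * int m + 1)\<^esub> fst (pert m n (x', y')),
     snd (pert m n (x, y)) \<oplus>\<^bsub>grp N (n + 2 * int m + 2)\<^esub> snd (pert m n (x', y')))"
  using pert.add[of "(x, y)" n "(x', y')" m] assms by (simp add: cone_add add_ac)

lemma strong_H_hom: "graded_hom M M (2 * int m + 1) (strong_H m)"
proof (rule graded_homI)
  fix n x y assume "x \<in> carrier (grp M n)" "y \<in> carrier (grp M n)"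
  then show "strong_H m n (x \<oplus>\<^bsub>grp M n\<^esub> y) = strong_H m n x \<oplus>\<^bsub>grp M (n + (2 * int m + 1))\<^esub> strong_H m n y"
    using pert_add[of x n y "\<zero>\<^bsub>grp N (n + 1)\<^esub>" "\<zero>\<^bsub>grp N (n + 1)\<^esub>" m] by (simp add: strong_H_def add_ac)
qed (simp_all add: strong_H_def M.grp.abelian_group_axioms)

lemma strong_F_hom: "graded_hom M N (2 * int m) (strong_F m)"
proof (cases m)
  case 0
  have "strong_F 0 = F" by (intro ext) simp
  then show ?thesis using F.graded_hom_axioms 0 by simp
next
  case (Suc j)
  show ?thesis unfolding Suc
  proof (rule graded_homI)
    fix n x y assume "x \<in> carrier (grp M n)" "y \<in> carrier (grp M n)"
    then show "strong_F (Suc j) n (x \<oplus>\<^bsub>grp M n\<^esub> y)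
        = strong_F (Suc j) n x \<oplus>\<^bsub>grp N (n + 2 * int (Suc j))\<^esub> strong_F (Suc j) n y"
      using pert_add[of x n y "\<zero>\<^bsub>grp N (n + 1)\<^esub>" "\<zero>\<^bsub>grp N (n + 1)\<^esub>" j] by (simp add: add_ac)
  qed (simp_all add: M.grp.abelian_group_axioms N.grp.abelian_group_axioms)
qed

declare strong_F.simps(2) [simp del]

lemma strong_G_hom: "graded_hom N M (2 * int m) (strong_G m)"
proof (rule graded_homI)
  fix n x y assume "x \<in> carrier (grp N n)" "y \<in> carrier (grp N n)"
  then show "strong_G m n (x \<oplus>\<^bsub>grp N n\<^esub> y) = strong_G m n x \<oplus>\<^bsub>grp M (n + 2 * int m)\<^esub> strong_G m n y"
    using pert_add[of "\<zero>\<^bsub>grp M (n - 1)\<^esub>" "n - 1" "\<zero>\<^bsub>grp M (n - 1)\<^esub>" x y m]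
    by (simp add: strong_G_def M.grp.minus_add add_ac)
qed (simp_all add: strong_G_def M.grp.abelian_group_axioms N.grp.abelian_group_axioms)

lemma strong_L_hom: "graded_hom N N (2 * int m + 1) (strong_L m)"
proof (rule graded_homI)
  fix n x y assume "x \<in> carrier (grp N n)" "y \<in> carrier (grp N n)"
  then show "strong_L m n (x \<oplus>\<^bsub>grp N n\<^esub> y) = strong_L m n x \<oplus>\<^bsub>grp N (n + (2 * int m + 1))\<^esub> strong_L m n y"
    using pert_add[of "\<zero>\<^bsub>grp M (n - 1)\<^esub>" "n - 1" "\<zero>\<^bsub>grp M (n - 1)\<^esub>" x y m]
    by (simp add: strong_L_def N.grp.minus_add add_ac)
qed (simp_all add: strong_L_def N.grp.abelian_group_axioms add_ac)

sublocale sH: graded_hom M M "2 * int m + 1" "strong_H m" for m by (rule strong_H_hom)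
sublocale sF: graded_hom M N "2 * int m" "strong_F m" for m by (rule strong_F_hom)
sublocale sG: graded_hom N M "2 * int m" "strong_G m" for m by (rule strong_G_hom)
sublocale sL: graded_hom N N "2 * int m + 1" "strong_L m" for m by (rule strong_L_hom)

text \<open>Additivity on (x, y) = (x, 0) + (0, y) recovers the matrix from its columns.\<close>

lemma pert_apply:
  assumes "x \<in> carrier (grp M n)" "y \<in> carrier (grp N (n + 1))"
  shows "pert m n (x, y) =
    (strong_H m n x \<ominus>\<^bsub>grp M (n + 2 * int m + 1)\<^esub> strong_G m (n + 1) y,
     strong_F (Suc m) n x \<ominus>\<^bsub>grp N (n + 2 * int m + 2)\<^esub> strong_L m (n + 1) y)"
  using pert_add[of x n "\<zero>\<^bsub>grp M n\<^esub>" "\<zero>\<^bsub>grp N (n + 1)\<^esub>" y m] assms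
  by (simp add: strong_H_def strong_F.simps strong_G_def strong_L_def M.grp.minus_eq N.grp.minus_eq
      M.grp.minus_minus N.grp.minus_minus add_ac)

text \<open>Since \<open>pert 0\<close> is \<open>contr\<close>, the blocks of lowest index are the
  data from which it was built.\<close>

lemma strong_0:
  "x \<in> carrier (grp M n) \<Longrightarrow> strong_H 0 n x = H n x"
  "y \<in> carrier (grp N n) \<Longrightarrow> strong_G 0 n y = G n y"
  "y \<in> carrier (grp N n) \<Longrightarrow> strong_L 0 n y = L n y"
  "x \<in> carrier (grp M n) \<Longrightarrow> strong_F (Suc 0) n x = K n x"
  by (simp_all add: strong_H_def strong_F.simps strong_G_def strong_L_def pert_0 M.grp.abelian_simps N.grp.abelian_simps add_ac)

lemma pert_M: "pert m n (x, \<zero>\<^bsub>grp N (n + 1)\<^esub>) = (strong_H m n x, strong_F (Suc m) n x)"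
  by (simp add: strong_H_def strong_F.simps)

text \<open>Evaluate \<open>pert_master\<close> at (x, 0) and compare components. Products of two
  perturbation blocks give all summands except those containing F_0; these come from the entry
  \<open>F\<close> of the cone differential.\<close>

lemma strong_HF_bd:
  assumes x: "x \<in> carrier (grp M n)"
  shows strong_H_bd: "bd M (n + 2 * int m + 3) (strong_H (Suc m) n x)
      \<oplus>\<^bsub>grp M (n + 2 * int m + 2)\<^esub> strong_H (Suc m) (n - 1) (bd M n x)
    = (\<Oplus>\<^bsub>grp M (n + 2 * int m + 2)\<^esub>j\<in>{..Suc m}.
        strong_G j (n + 2 * int (Suc m - j)) (strong_F (Suc m - j) n x))
      \<ominus>\<^bsub>grp M (n + 2 * int m + 2)\<^esub>
      (\<Oplus>\<^bsub>grp M (n + 2 * int m + 2)\<^esub>j\<in>{..m}.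
        strong_H j (n + 2 * int (m - j) + 1) (strong_H (m - j) n x))" (is ?H)
    and strong_F_bd: "bd N (n + 2 * int m + 4) (strong_F (Suc (Suc m)) n x)
      \<ominus>\<^bsub>grp N (n + 2 * int m + 3)\<^esub> strong_F (Suc (Suc m)) (n - 1) (bd M n x)
    = (\<Oplus>\<^bsub>grp N (n + 2 * int m + 3)\<^esub>i\<in>{..Suc m}.
        strong_F i (n + 2 * int (Suc m - i) + 1) (strong_H (Suc m - i) n x)
        \<ominus>\<^bsub>grp N (n + 2 * int m + 3)\<^esub> strong_L (Suc m - i) (n + 2 * int i) (strong_F i n x))" (is ?F)
proof -
  let ?A = "grp M (n + 2 * int m + 2)" and ?B = "grp N (n + 2 * int m + 3)"
  let ?f = "\<lambda>i. pert i (n + 2 * int (m - i) + 1) (pert (m - i) n (x, \<zero>\<^bsub>grp N (n + 1)\<^esub>))"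
  let ?h = "\<lambda>i. strong_H i (n + 2 * int (m - i) + 1) (strong_H (m - i) n x)"
  let ?g = "\<lambda>i. strong_G i (n + 2 * int (Suc m - i)) (strong_F (Suc m - i) n x)"
  let ?u = "\<lambda>i. strong_F i (n + 2 * int (Suc m - i) + 1) (strong_H (Suc m - i) n x)"
  let ?v = "\<lambda>i. strong_L i (n + 2 * int (Suc m - i)) (strong_F (Suc m - i) n x)"
  \<comment> \<open>One matrix product: \<open>pert i\<close> applied to the first column of
    \<open>pert (m - i)\<close>. In the N component the block of \<open>pert i\<close> is F_(2i+2),
    whence \<open>?u (Suc i)\<close>; the term \<open>?u 0\<close> is supplied by the cone
    differential.\<close>
  have f: "?f i = (?h i \<ominus>\<^bsub>?A\<^esub> ?g i, ?u (Suc i) \<ominus>\<^bsub>?B\<^esub> ?v i)" if "i \<le> m" for i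
  proof -
    let ?k = "n + 2 * int (m - i) + 1"
    have "?k + 2 * int i + 1 = n + 2 * int m + 2" "?k + 2 * int i + 2 = n + 2 * int m + 3"
      "Suc m - i = Suc (m - i)" "?k + 1 = n + 2 * int (Suc (m - i))"
      using that by simp_all
    then show ?thesis
      using pert_apply[of "strong_H (m - i) n x" ?k "strong_F (Suc (m - i)) n x" i] x
      unfolding pert_M by (simp add: add_ac)
  qed
  have car: "?h \<in> {..m} \<rightarrow> carrier ?A" "?g \<in> {..Suc m} \<rightarrow> carrier ?A"
    "?u \<in> {..Suc m} \<rightarrow> carrier ?B" "?v \<in> {..Suc m} \<rightarrow> carrier ?B"
    using x by (auto simp: of_nat_diff)
  have S: "(\<Oplus>\<^bsub>grp C (n + 2 * int m + 2)\<^esub>i\<in>{..m}. ?f i) =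
     ((\<Oplus>\<^bsub>?A\<^esub>i\<in>{..m}. ?h i \<ominus>\<^bsub>?A\<^esub> ?g i), (\<Oplus>\<^bsub>?B\<^esub>i\<in>{..m}. ?u (Suc i) \<ominus>\<^bsub>?B\<^esub> ?v i))"
    using x by (intro cone_finsum f) (auto simp: of_nat_diff)
  have master: "bd C (n + 2 * int m + 3) (strong_H (Suc m) n x, strong_F (Suc (Suc m)) n x)
      \<oplus>\<^bsub>grp C (n + 2 * int m + 2)\<^esub> pert (Suc m) (n - 1) (bd M n x, F n x)
      \<oplus>\<^bsub>grp C (n + 2 * int m + 2)\<^esub> ((\<Oplus>\<^bsub>?A\<^esub>i\<in>{..m}. ?h i \<ominus>\<^bsub>?A\<^esub> ?g i), (\<Oplus>\<^bsub>?B\<^esub>i\<in>{..m}. ?u (Suc i) \<ominus>\<^bsub>?B\<^esub> ?v i))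
      = (\<zero>\<^bsub>?A\<^esub>, \<zero>\<^bsub>?B\<^esub>)"
    using pert_master[of "(x, \<zero>\<^bsub>grp N (n + 1)\<^esub>)" n m] x unfolding S unfolding pert_M
    by (simp add: N.grp.minus_zero_simps add_ac)
  have A: "bd M (n + 2 * int m + 3) (strong_H (Suc m) n x)
      \<oplus>\<^bsub>?A\<^esub> (strong_H (Suc m) (n - 1) (bd M n x) \<ominus>\<^bsub>?A\<^esub> ?g (Suc m))
      \<oplus>\<^bsub>?A\<^esub> (\<Oplus>\<^bsub>?A\<^esub>i\<in>{..m}. ?h i \<ominus>\<^bsub>?A\<^esub> ?g i) = \<zero>\<^bsub>?A\<^esub>"
    using arg_cong[OF master, of fst] x
    by (simp add: cone_add pert_apply add_ac)
  have B: "F (n + 2 * int m + 3) (strong_H (Suc m) n x)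
      \<ominus>\<^bsub>?B\<^esub> bd N (n + 2 * int m + 4) (strong_F (Suc (Suc m)) n x)
      \<oplus>\<^bsub>?B\<^esub> (strong_F (Suc (Suc m)) (n - 1) (bd M n x) \<ominus>\<^bsub>?B\<^esub> ?v (Suc m))
      \<oplus>\<^bsub>?B\<^esub> (\<Oplus>\<^bsub>?B\<^esub>i\<in>{..m}. ?u (Suc i) \<ominus>\<^bsub>?B\<^esub> ?v i) = \<zero>\<^bsub>?B\<^esub>"
    using arg_cong[OF master, of snd] x
    by (simp add: cone_add pert_apply add_ac)
  show ?H
    using A car x
    by (simp add: M.grp.finsum_minus M.grp.finsum_Suc Pi_iff)
      (simp add: M.grp.abelian_simps Pi_iff)
  \<comment> \<open>The sum to be reached is indexed by the inner factor \<open>strong_F i\<close>,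
    the one obtained by the outer factor \<open>strong_L i\<close>, so it is reversed.\<close>
  let ?v' = "\<lambda>i. strong_L (Suc m - i) (n + 2 * int i) (strong_F i n x)"
  have v': "?v' \<in> {..Suc m} \<rightarrow> carrier ?B"
    using x by (auto simp: of_nat_diff)
  have "finsum ?B ?v' {..Suc m} = (\<Oplus>\<^bsub>?B\<^esub>i\<in>{..Suc m}. ?v (Suc m - i))"
    using v' by (intro N.grp.finsum_cong') (auto simp: Pi_iff)
  also have "\<dots> = finsum ?B ?v {..Suc m}"
    using car(4) by (rule N.grp.finsum_atMost_reverse)
  also have "\<dots> = ?v (Suc m) \<oplus>\<^bsub>?B\<^esub> finsum ?B ?v {..m}"
    using car(4) by (intro N.grp.finsum_Suc)
  finally have V: "finsum ?B ?v' {..Suc m} = \<dots>" .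
  have U: "finsum ?B ?u {..Suc m} = (\<Oplus>\<^bsub>?B\<^esub>i\<in>{..m}. ?u (Suc i)) \<oplus>\<^bsub>?B\<^esub> ?u 0"
    using car(3) by (intro N.grp.finsum_Suc2)
  have UV: "(\<Oplus>\<^bsub>?B\<^esub>i\<in>{..m}. ?u (Suc i) \<ominus>\<^bsub>?B\<^esub> ?v i) = (\<Oplus>\<^bsub>?B\<^esub>i\<in>{..m}. ?u (Suc i)) \<ominus>\<^bsub>?B\<^esub> finsum ?B ?v {..m}"
    using x by (intro N.grp.finsum_minus) (auto simp: of_nat_diff)
  have UV': "(\<Oplus>\<^bsub>?B\<^esub>i\<in>{..Suc m}. ?u i \<ominus>\<^bsub>?B\<^esub> ?v' i) = finsum ?B ?u {..Suc m} \<ominus>\<^bsub>?B\<^esub> finsum ?B ?v' {..Suc m}"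
    using car(3) v' by (intro N.grp.finsum_minus) auto
  have "finsum ?B ?v {..m} \<in> carrier ?B" "(\<Oplus>\<^bsub>?B\<^esub>i\<in>{..m}. ?u (Suc i)) \<in> carrier ?B"
    "?u 0 \<in> carrier ?B" "?v (Suc m) \<in> carrier ?B"
    using x by (auto simp: of_nat_diff intro!: N.grp.finsum_closed)
  then show ?F
    using B x unfolding UV UV' U V
    by (simp add: N.grp.abelian_simps add_ac)
qed

lemma pert_N:
  assumes "y \<in> carrier (grp N n)"
  shows "pert m (n - 1) (\<zero>\<^bsub>grp M (n - 1)\<^esub>, y) =
    (\<ominus>\<^bsub>grp M (n + 2 * int m)\<^esub> strong_G m n y, \<ominus>\<^bsub>grp N (n + 2 * int m + 1)\<^esub> strong_L m n y)"
  using assms by (simp add: strong_G_def strong_L_def M.grp.minus_minus N.grp.minus_minus)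

text \<open>Evaluate \<open>pert_master\<close> at (0, y). The cone differential sends this element
  to (0, -dy), so \<open>F\<close> enters only once, in the term F_0 G of the N component; the M
  component already contains every summand of the equation for G.\<close>

lemma strong_GL_bd:
  assumes y: "y \<in> carrier (grp N n)"
  shows strong_G_bd: "bd M (n + 2 * int m + 2) (strong_G (Suc m) n y)
      \<ominus>\<^bsub>grp M (n + 2 * int m + 1)\<^esub> strong_G (Suc m) (n - 1) (bd N n y)
    = (\<Oplus>\<^bsub>grp M (n + 2 * int m + 1)\<^esub>i\<in>{..m}.
        strong_G i (n + 2 * int (m - i) + 1) (strong_L (m - i) n y)
        \<ominus>\<^bsub>grp M (n + 2 * int m + 1)\<^esub> strong_H (m - i) (n + 2 * int i) (strong_G i n y))" (is ?G)
    and strong_L_bd: "bd N (n + 2 * int m + 3) (strong_L (Suc m) n y)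
      \<oplus>\<^bsub>grp N (n + 2 * int m + 2)\<^esub> strong_L (Suc m) (n - 1) (bd N n y)
    = (\<Oplus>\<^bsub>grp N (n + 2 * int m + 2)\<^esub>j\<in>{..Suc m}.
        strong_F j (n + 2 * int (Suc m - j)) (strong_G (Suc m - j) n y))
      \<ominus>\<^bsub>grp N (n + 2 * int m + 2)\<^esub>
      (\<Oplus>\<^bsub>grp N (n + 2 * int m + 2)\<^esub>j\<in>{..m}.
        strong_L j (n + 2 * int (m - j) + 1) (strong_L (m - j) n y))" (is ?L)
proof -
  let ?A = "grp M (n + 2 * int m + 1)" and ?B = "grp N (n + 2 * int m + 2)"
  let ?f = "\<lambda>i. pert i (n - 1 + 2 * int (m - i) + 1) (pert (m - i) (n - 1) (\<zero>\<^bsub>grp M (n - 1)\<^esub>, y))"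
  let ?g = "\<lambda>i. strong_G i (n + 2 * int (m - i) + 1) (strong_L (m - i) n y)"
  let ?h = "\<lambda>i. strong_H i (n + 2 * int (m - i)) (strong_G (m - i) n y)"
  let ?h' = "\<lambda>i. strong_H (m - i) (n + 2 * int i) (strong_G i n y)"
  let ?u = "\<lambda>i. strong_F i (n + 2 * int (Suc m - i)) (strong_G (Suc m - i) n y)"
  let ?l = "\<lambda>i. strong_L i (n + 2 * int (m - i) + 1) (strong_L (m - i) n y)"
  have f: "?f i = (?g i \<ominus>\<^bsub>?A\<^esub> ?h i, ?l i \<ominus>\<^bsub>?B\<^esub> ?u (Suc i))" if "i \<le> m" for i
  proof -
    let ?k = "n + 2 * int (m - i)"
    have k: "?k + 2 * int i + 1 = n + 2 * int m + 1" "?k + 2 * int i + 2 = n + 2 * int m + 2"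
      "n - 1 + 2 * int (m - i) + 1 = ?k"
      using that by simp_all
    show ?thesis
      using pert_apply[of "\<ominus>\<^bsub>grp M ?k\<^esub> strong_G (m - i) n y" ?k "\<ominus>\<^bsub>grp N (?k + 1)\<^esub> strong_L (m - i) n y" i] y that
      unfolding pert_N[OF y] k by (simp add: M.grp.minus_simps N.grp.minus_simps add_ac of_nat_diff)
  qed
  have h: "(\<Oplus>\<^bsub>?A\<^esub>i\<in>{..m}. ?h' i) = finsum ?A ?h {..m}"
  proof -
    have "(\<Oplus>\<^bsub>?A\<^esub>i\<in>{..m}. ?h' i) = (\<Oplus>\<^bsub>?A\<^esub>i\<in>{..m}. ?h (m - i))"
      using y by (intro M.grp.finsum_cong') (auto simp: of_nat_diff)
    also have "\<dots> = finsum ?A ?h {..m}"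
      using y by (intro M.grp.finsum_atMost_reverse) (auto simp: of_nat_diff)
    finally show ?thesis .
  qed
  have S: "(\<Oplus>\<^bsub>grp C (n - 1 + 2 * int m + 2)\<^esub>i\<in>{..m}. ?f i) =
     ((\<Oplus>\<^bsub>?A\<^esub>i\<in>{..m}. ?g i \<ominus>\<^bsub>?A\<^esub> ?h i), (\<Oplus>\<^bsub>?B\<^esub>i\<in>{..m}. ?l i \<ominus>\<^bsub>?B\<^esub> ?u (Suc i)))"
    using y cone_finsum[of "{..m}" ?f "\<lambda>i. ?g i \<ominus>\<^bsub>?A\<^esub> ?h i" "\<lambda>i. ?l i \<ominus>\<^bsub>?B\<^esub> ?u (Suc i)"
      "n + 2 * int m + 2" "n + 2 * int m + 1"] f
    by (simp add: Pi_iff of_nat_diff add_ac)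
  \<comment> \<open>As \<open>y\<close> has cone degree n-1, all degrees are one lower than in the
    computation for the first column.\<close>
  have master: "bd C (n + 2 * int m + 2) (\<ominus>\<^bsub>grp M (n + 2 * int m + 2)\<^esub> strong_G (Suc m) n y,
        \<ominus>\<^bsub>grp N (n + 2 * int m + 3)\<^esub> strong_L (Suc m) n y)
      \<oplus>\<^bsub>grp C (n + 2 * int m + 1)\<^esub> pert (Suc m) (n - 2) (\<zero>\<^bsub>grp M (n - 2)\<^esub>, \<ominus>\<^bsub>grp N (n - 1)\<^esub> bd N n y)
      \<oplus>\<^bsub>grp C (n + 2 * int m + 1)\<^esub> ((\<Oplus>\<^bsub>?A\<^esub>i\<in>{..m}. ?g i \<ominus>\<^bsub>?A\<^esub> ?h i), (\<Oplus>\<^bsub>?B\<^esub>i\<in>{..m}. ?l i \<ominus>\<^bsub>?B\<^esub> ?u (Suc i)))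
      = (\<zero>\<^bsub>?A\<^esub>, \<zero>\<^bsub>?B\<^esub>)"
    using pert_master[of "(\<zero>\<^bsub>grp M (n - 1)\<^esub>, y)" "n - 1" m] y unfolding S unfolding pert_N[OF y]
    by (simp add: N.grp.minus_zero_simps add_ac)
  \<comment> \<open>The sign of -dy cancels the sign of the second column.\<close>
  have P: "pert (Suc m) (n - 2) (\<zero>\<^bsub>grp M (n - 2)\<^esub>, \<ominus>\<^bsub>grp N (n - 1)\<^esub> bd N n y) =
      (strong_G (Suc m) (n - 1) (bd N n y), strong_L (Suc m) (n - 1) (bd N n y))"
    using pert_N[of "\<ominus>\<^bsub>grp N (n - 1)\<^esub> bd N n y" "n - 1" "Suc m"] y
    by (simp add: M.grp.minus_minus N.grp.minus_minus)
  have A: "\<ominus>\<^bsub>?A\<^esub> bd M (n + 2 * int m + 2) (strong_G (Suc m) n y) \<oplus>\<^bsub>?A\<^esub> strong_G (Suc m) (n - 1) (bd N n y)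
      \<oplus>\<^bsub>?A\<^esub> (\<Oplus>\<^bsub>?A\<^esub>i\<in>{..m}. ?g i \<ominus>\<^bsub>?A\<^esub> ?h i) = \<zero>\<^bsub>?A\<^esub>"
    using arg_cong[OF master, of fst] y unfolding P by (simp add: cone_add add_ac)
  have B: "\<ominus>\<^bsub>?B\<^esub> F (n + 2 * int m + 2) (strong_G (Suc m) n y)
      \<ominus>\<^bsub>?B\<^esub> \<ominus>\<^bsub>?B\<^esub> bd N (n + 2 * int m + 3) (strong_L (Suc m) n y) \<oplus>\<^bsub>?B\<^esub> strong_L (Suc m) (n - 1) (bd N n y)
      \<oplus>\<^bsub>?B\<^esub> (\<Oplus>\<^bsub>?B\<^esub>i\<in>{..m}. ?l i \<ominus>\<^bsub>?B\<^esub> ?u (Suc i)) = \<zero>\<^bsub>?B\<^esub>"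
    using arg_cong[OF master, of snd] y unfolding P by (simp add: cone_add add_ac)
  have GH: "(\<Oplus>\<^bsub>?A\<^esub>i\<in>{..m}. ?g i \<ominus>\<^bsub>?A\<^esub> ?h i) = finsum ?A ?g {..m} \<ominus>\<^bsub>?A\<^esub> finsum ?A ?h {..m}"
    using y by (intro M.grp.finsum_minus) (auto simp: of_nat_diff)
  have GH': "(\<Oplus>\<^bsub>?A\<^esub>i\<in>{..m}. ?g i \<ominus>\<^bsub>?A\<^esub> ?h' i) = finsum ?A ?g {..m} \<ominus>\<^bsub>?A\<^esub> finsum ?A ?h {..m}"
    unfolding h[symmetric] using y by (intro M.grp.finsum_minus) (auto simp: of_nat_diff)
  have "finsum ?A ?g {..m} \<in> carrier ?A" "finsum ?A ?h {..m} \<in> carrier ?A"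
    using y by (auto simp: of_nat_diff intro!: M.grp.finsum_closed)
  then show ?G
    using A y unfolding GH GH' by (simp add: M.grp.abelian_simps add_ac)
  have LU: "(\<Oplus>\<^bsub>?B\<^esub>i\<in>{..m}. ?l i \<ominus>\<^bsub>?B\<^esub> ?u (Suc i)) = finsum ?B ?l {..m} \<ominus>\<^bsub>?B\<^esub> (\<Oplus>\<^bsub>?B\<^esub>i\<in>{..m}. ?u (Suc i))"
    using y by (intro N.grp.finsum_minus) (auto simp: of_nat_diff)
  have U: "finsum ?B ?u {..Suc m} = (\<Oplus>\<^bsub>?B\<^esub>i\<in>{..m}. ?u (Suc i)) \<oplus>\<^bsub>?B\<^esub> ?u 0"
    using y by (intro N.grp.finsum_Suc2) (auto simp: of_nat_diff)
  have "finsum ?B ?l {..m} \<in> carrier ?B" "(\<Oplus>\<^bsub>?B\<^esub>i\<in>{..m}. ?u (Suc i)) \<in> carrier ?B" "?u 0 \<in> carrier ?B"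
    using y by (auto simp: of_nat_diff intro!: N.grp.finsum_closed)
  then show ?L
    using B y unfolding LU U by (simp add: N.grp.abelian_simps add_ac)
qed

text \<open>F_2 belongs to the linear term, so its equation is the hypothesis \<open>K_bd\<close>;
  the members of higher degree are covered by \<open>pert_master\<close>.\<close>

lemma strong_F_bd_Suc:
  assumes "x \<in> carrier (grp M n)"
  shows "bd N (n + 2 * int m + 2) (strong_F (Suc m) n x)
      \<ominus>\<^bsub>grp N (n + 2 * int m + 1)\<^esub> strong_F (Suc m) (n - 1) (bd M n x)
    = (\<Oplus>\<^bsub>grp N (n + 2 * int m + 1)\<^esub>i\<in>{..m}.
        strong_F i (n + 2 * int (m - i) + 1) (strong_H (m - i) n x)
        \<ominus>\<^bsub>grp N (n + 2 * int m + 1)\<^esub> strong_L (m - i) (n + 2 * int i) (strong_F i n x))"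
proof (cases m)
  case 0
  then show ?thesis
    using assms K_bd[OF assms] by (simp add: strong_0)
next
  case (Suc k)
  then show ?thesis
    using strong_F_bd[OF assms, of k] by (simp add: add_ac)
qed

end

section \<open>Translation to graded maps\<close>

lemma graded_maps_eq_iff:
  assumes "chain_complex M" "chain_complex N" "\<phi> \<in> graded_maps M N k" "\<psi> \<in> graded_maps M N k"
  shows "\<phi> = \<psi> \<longleftrightarrow> (\<forall>n. \<forall>x\<in>carrier (grp M n). \<phi> n x = \<psi> n x)"
  using graded_maps_eqI[OF assms] by blast

lemma graded_comp_graded_maps:
  assumes "chain_complex M" "chain_complex N" "chain_complex P"
    and "\<phi> \<in> graded_maps M N k" "\<psi> \<in> graded_maps N P l" "m = k + l"
  shows "\<psi> \<star>\<^bsub>M,k\<^esub> \<phi> \<in> graded_maps M P m"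
  using assms by (intro graded_comp_closed[OF graded_maps_hom graded_maps_hom])

lemma graded_comp_bd:
  assumes "chain_complex M" "chain_complex N" "\<phi> \<in> graded_maps M N k" "m = k - 1"
  shows bd_comp_closed: "bd N \<star>\<^bsub>M,k\<^esub> \<phi> \<in> graded_maps M N m"
    and comp_bd_closed: "\<phi> \<star>\<^bsub>M,-1\<^esub> bd M \<in> graded_maps M N m"
proof -
  interpret M: chain_complex M by fact
  interpret N: chain_complex N by fact
  have "graded_hom M N k \<phi>" using assms by (intro graded_maps_hom)
  then show "bd N \<star>\<^bsub>M,k\<^esub> \<phi> \<in> graded_maps M N m" "\<phi> \<star>\<^bsub>M,-1\<^esub> bd M \<in> graded_maps M N m"
    using assms(4) by (auto intro: graded_comp_closed N.bd.graded_hom_axioms M.bd.graded_hom_axioms)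
qed

lemma homotopy_equivalence_iff:
  assumes M: "chain_complex M" and N: "chain_complex N"
  shows "homotopy_equivalence M N F G H L \<longleftrightarrow>
    F \<in> graded_maps M N 0 \<and> G \<in> graded_maps N M 0 \<and>
    H \<in> graded_maps M M 1 \<and> L \<in> graded_maps N N 1 \<and>
    (\<forall>n. \<forall>x\<in>carrier (grp M n). F (n - 1) (bd M n x) = bd N n (F n x)) \<and>
    (\<forall>n. \<forall>y\<in>carrier (grp N n). G (n - 1) (bd N n y) = bd M n (G n y)) \<and>
    (\<forall>n. \<forall>x\<in>carrier (grp M n). G n (F n x) \<ominus>\<^bsub>grp M n\<^esub> x =
      bd M (n + 1) (H n x) \<oplus>\<^bsub>grp M n\<^esub> H (n - 1) (bd M n x)) \<and>
    (\<forall>n. \<forall>y\<in>carrier (grp N n). F n (G n y) \<ominus>\<^bsub>grp N n\<^esub> y =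
      bd N (n + 1) (L n y) \<oplus>\<^bsub>grp N n\<^esub> L (n - 1) (bd N n y))"
\<comment> \<open>Equations of composites become pointwise once the composites are known to be
  graded maps, which holds if the four maps are; otherwise both sides are false.\<close>
proof (cases "F \<in> graded_maps M N 0 \<and> G \<in> graded_maps N M 0 \<and> H \<in> graded_maps M M 1 \<and> L \<in> graded_maps N N 1")
  case True
  then have m: "F \<in> graded_maps M N 0" "G \<in> graded_maps N M 0" "H \<in> graded_maps M M 1" "L \<in> graded_maps N N 1"
    by auto
  note closed = graded_comp_graded_maps[OF M N M m(1,2)] graded_comp_graded_maps[OF N M N m(2,1)]
    graded_comp_bd[OF M N m(1)] graded_comp_bd[OF N M m(2)] graded_comp_bd[OF M M m(3)] graded_comp_bd[OF N N m(4)]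
    id_map_closed[OF M] id_map_closed[OF N]
  note eq = graded_maps_eq_iff[OF M N, of _ "-1"] graded_maps_eq_iff[OF N M, of _ "-1"]
    graded_maps_eq_iff[OF M M, of _ "0"] graded_maps_eq_iff[OF N N, of _ "0"]
  show ?thesis
    unfolding homotopy_equivalence_def using m
    by (simp add: eq closed M N)
next
  case False
  then show ?thesis unfolding homotopy_equivalence_def by blast
qed

section \<open>Boundaries in the Hom complex; an extension forces the obstruction to vanish\<close>

text \<open>Restricting to cycles changes only the carrier, and cosets depend only on the addition.
  In \<open>grp C n\<close> the coset of a member of the image subgroup is that subgroup, the unit
  of the quotient.\<close>

lemma homology_class_boundary:
  assumes "abelian_group_hom (grp C (n + 1)) (grp C n) (bd C (n + 1))" "z \<in> boundaries C n"
  shows "homology_class C n z = \<one>\<^bsub>homology C n\<^esub>"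
proof -
  interpret abelian_group_hom "grp C (n + 1)" "grp C n" "bd C (n + 1)" by fact
  have "subgroup (boundaries C n) (add_monoid (grp C n))"
    using group_hom.img_is_subgroup[OF a_group_hom] by (simp add: boundaries_def)
  then have "boundaries C n +>\<^bsub>grp C n\<^esub> z = boundaries C n"
    using subgroup.rcos_const[OF _ H.a_group assms(2)] by (simp add: a_r_coset_def)
  then show ?thesis
    by (simp add: homology_class_def homology_def A_FactGroup_def FactGroup_def cycles_def a_r_coset_def')
qed

text \<open>For the obstruction only the boundaries of degree 2 maps matter, which are differences;
  they form a subgroup as the image of this homomorphism.\<close>

lemma Hom_bd_even_hom:
  assumes M: "chain_complex M" and N: "chain_complex N" and k: "even k"
  shows "abelian_group_hom (grp (Hom M N) k) (grp (Hom M N) (k - 1)) (bd (Hom M N) k)"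
proof -
  interpret M: chain_complex M by fact
  interpret N: chain_complex N by fact
  note [simp] = M N Hom_def
  note closed = graded_comp_bd[OF M N]
  show ?thesis
  proof (rule abelian_group_homI')
    fix \<phi> \<psi> assume "\<phi> \<in> carrier (grp (Hom M N) k)" "\<psi> \<in> carrier (grp (Hom M N) k)"
    then have *: "\<phi> \<in> graded_maps M N k" "\<psi> \<in> graded_maps M N k" by simp_all
    interpret p: graded_hom M N k \<phi> using * by (simp add: graded_maps_hom)
    interpret q: graded_hom M N k \<psi> using * by (simp add: graded_maps_hom)
    have "(bd N \<star>\<^bsub>M,k\<^esub> (\<phi> \<oplus>\<^bsub>Hom_grp M N k\<^esub> \<psi>)) \<ominus>\<^bsub>Hom_grp M N (k - 1)\<^esub> ((\<phi> \<oplus>\<^bsub>Hom_grp M N k\<^esub> \<psi>) \<star>\<^bsub>M,-1\<^esub> bd M) =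
       ((bd N \<star>\<^bsub>M,k\<^esub> \<phi>) \<ominus>\<^bsub>Hom_grp M N (k - 1)\<^esub> (\<phi> \<star>\<^bsub>M,-1\<^esub> bd M)) \<oplus>\<^bsub>Hom_grp M N (k - 1)\<^esub>
       ((bd N \<star>\<^bsub>M,k\<^esub> \<psi>) \<ominus>\<^bsub>Hom_grp M N (k - 1)\<^esub> (\<psi> \<star>\<^bsub>M,-1\<^esub> bd M))"
      by (rule graded_maps_eqI[OF M N, of _ "k - 1"])
        (simp_all add: closed[OF *(1)] closed[OF *(2)] closed[OF graded_maps_add[OF M N *]] N.grp.abelian_simps add_diff_eq diff_add_eq)
    then show "bd (Hom M N) k (\<phi> \<oplus>\<^bsub>grp (Hom M N) k\<^esub> \<psi>) =
        bd (Hom M N) k \<phi> \<oplus>\<^bsub>grp (Hom M N) (k - 1)\<^esub> bd (Hom M N) k \<psi>"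
      using k by simp
  qed (use k closed in \<open>simp_all add: abelian_group_Hom_grp\<close>)
qed

lemma homology_class_Hom_eq_one:
  assumes "chain_complex M" "chain_complex N" "K \<in> graded_maps M N 2"
    and "(bd N \<star>\<^bsub>M,2\<^esub> K) \<ominus>\<^bsub>Hom_grp M N 1\<^esub> (K \<star>\<^bsub>M,-1\<^esub> bd M) = \<phi>"
  shows "homology_class (Hom M N) 1 \<phi> = \<one>\<^bsub>homology (Hom M N) 1\<^esub>"
proof (rule homology_class_boundary)
  show "abelian_group_hom (grp (Hom M N) (1 + 1)) (grp (Hom M N) 1) (bd (Hom M N) (1 + 1))"
    using Hom_bd_even_hom[OF assms(1,2), of 2] by simp
  show "\<phi> \<in> boundaries (Hom M N) 1"
    unfolding boundaries_def using assms by (auto simp: Hom_def intro!: image_eqI[of _ _ K])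
qed

text \<open>Interchanging M and N permutes the equations of the definition among themselves.\<close>

lemma strong_homotopy_equivalence_swap:
  "strong_homotopy_equivalence M N F G H L \<Longrightarrow> strong_homotopy_equivalence N M G F L H"
  unfolding strong_homotopy_equivalence_def by blast

text \<open>F_2 is a filling of FH - LF: this is the equation for F at m = 1.\<close>

lemma strong_imp_obstruction_M:
  assumes M: "chain_complex M" and N: "chain_complex N" and "strong_homotopy_equivalence M N F G H L"
  shows "homology_class (Hom M N) 1 (obstruction_M M N (F 0) (G 0) (H 1) (L 1)) = \<one>\<^bsub>homology (Hom M N) 1\<^esub>"
proof (rule homology_class_Hom_eq_one[OF M N])
  note s = assms(3)[unfolded strong_homotopy_equivalence_def]
  have mem: "F (2 * m) \<in> graded_maps M N (int (2 * m)) \<and> H (2 * m + 1) \<in> graded_maps M M (int (2 * m + 1))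
      \<and> L (2 * m + 1) \<in> graded_maps N N (int (2 * m + 1))" for m using s by blast
  show "F 2 \<in> graded_maps M N 2" using mem[of 1] by simp
  have m: "F 0 \<in> graded_maps M N 0" "H 1 \<in> graded_maps M M 1" "L 1 \<in> graded_maps N N 1"
    using mem[of 0] by simp_all
  have c: "(F 0 \<star>\<^bsub>M,1\<^esub> H 1) \<ominus>\<^bsub>Hom_grp M N 1\<^esub> (L 1 \<star>\<^bsub>M,0\<^esub> F 0) \<in> graded_maps M N 1"
    using graded_comp_graded_maps[OF M M N m(2,1)] graded_comp_graded_maps[OF M N N m(1,3)]
    by (intro graded_maps_minus[OF M N]) auto
  interpret abelian_group "Hom_grp M N 1" using M N by (rule abelian_group_Hom_grp)
  \<comment> \<open>At m = 1 the sum has the single term i = 0, which is the obstruction.\<close>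
  have "(bd N \<star>\<^bsub>M,int (2*1)\<^esub> F (2*1)) \<ominus>\<^bsub>Hom_grp M N (int (2*1-1))\<^esub> (F (2*1) \<star>\<^bsub>M,-1\<^esub> bd M)
        = (\<Oplus>\<^bsub>Hom_grp M N (int (2*1-1))\<^esub>i\<in>{0..<1}.
            (F (2*i) \<star>\<^bsub>M,int (2*(1-i)-1)\<^esub> H (2*(1-i)-1))
              \<ominus>\<^bsub>Hom_grp M N (int (2*1-1))\<^esub> (L (2*(1-i)-1) \<star>\<^bsub>M,int (2*i)\<^esub> F (2*i)))"
    using s by blast
  then show "(bd N \<star>\<^bsub>M,2\<^esub> F 2) \<ominus>\<^bsub>Hom_grp M N 1\<^esub> (F 2 \<star>\<^bsub>M,-1\<^esub> bd M) = obstruction_M M N (F 0) (G 0) (H 1) (L 1)"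
    using c by (simp add: obstruction_M_def M N)
qed

text \<open>F_2 fills the obstruction on M and, by the symmetry, G_2 the one on N. In this way a
  filling of one class, once extended, makes both vanish.\<close>

lemma extends_to_strong_imp_obstruction_vanishes:
  assumes M: "chain_complex M" and N: "chain_complex N" and "extends_to_strong M N F G H L"
  shows "obstruction_vanishes M N F G H L"
proof -
  from assms(3) obtain Fs Gs Hs Ls where s: "strong_homotopy_equivalence M N Fs Gs Hs Ls"
    and eq: "Fs 0 = F" "Gs 0 = G" "Hs 1 = H" "Ls 1 = L"
    unfolding extends_to_strong_def by blast
  have "obstruction_N M N F G H L = obstruction_M N M G F L H"
    by (simp add: obstruction_M_def obstruction_N_def)
  then show ?thesis
    using strong_imp_obstruction_M[OF M N s] strong_imp_obstruction_M[OF N M strong_homotopy_equivalence_swap[OF s]]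
    unfolding obstruction_vanishes_def eq by simp
qed

section \<open>The strong homotopy equivalence made of the blocks\<close>

context filled_homotopy_equivalence
begin

text \<open>Restriction to the carriers makes the blocks extensional, hence graded maps, and
  \<open>d div 2\<close> passes from the degree of a member to its index.\<close>

definition F_family :: "nat \<Rightarrow> int \<Rightarrow> 'a \<Rightarrow> 'b" where
  "F_family d = (\<lambda>n. \<lambda>x\<in>carrier (grp M n). strong_F (d div 2) n x)"

definition G_family :: "nat \<Rightarrow> int \<Rightarrow> 'b \<Rightarrow> 'a" where
  "G_family d = (\<lambda>n. \<lambda>y\<in>carrier (grp N n). strong_G (d div 2) n y)"

definition H_family :: "nat \<Rightarrow> int \<Rightarrow> 'a \<Rightarrow> 'a" where
  "H_family d = (\<lambda>n. \<lambda>x\<in>carrier (grp M n). strong_H (d div 2) n x)"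

definition L_family :: "nat \<Rightarrow> int \<Rightarrow> 'b \<Rightarrow> 'b" where
  "L_family d = (\<lambda>n. \<lambda>y\<in>carrier (grp N n). strong_L (d div 2) n y)"

lemma family_apply [simp]:
  "x \<in> carrier (grp M n) \<Longrightarrow> F_family (2 * m) n x = strong_F m n x"
  "y \<in> carrier (grp N n) \<Longrightarrow> G_family (2 * m) n y = strong_G m n y"
  "x \<in> carrier (grp M n) \<Longrightarrow> H_family (Suc (2 * m)) n x = strong_H m n x"
  "y \<in> carrier (grp N n) \<Longrightarrow> L_family (Suc (2 * m)) n y = strong_L m n y"
  by (simp_all add: F_family_def G_family_def H_family_def L_family_def)

lemma family_closed:
  "k = 2 * int m \<Longrightarrow> F_family (2 * m) \<in> graded_maps M N k"
  "k = 2 * int m \<Longrightarrow> G_family (2 * m) \<in> graded_maps N M k"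
  "k = 2 * int m + 1 \<Longrightarrow> H_family (Suc (2 * m)) \<in> graded_maps M M k"
  "k = 2 * int m + 1 \<Longrightarrow> L_family (Suc (2 * m)) \<in> graded_maps N N k"
  using restrict_graded_maps[OF M.chain_complex_axioms N.chain_complex_axioms strong_F_hom[of m]]
    restrict_graded_maps[OF N.chain_complex_axioms M.chain_complex_axioms strong_G_hom[of m]]
    restrict_graded_maps[OF M.chain_complex_axioms M.chain_complex_axioms strong_H_hom[of m]]
    restrict_graded_maps[OF N.chain_complex_axioms N.chain_complex_axioms strong_L_hom[of m]]
  by (simp_all add: F_family_def G_family_def H_family_def L_family_def)

text \<open>Evaluated at an element this is \<open>strong_F_bd_Suc\<close>; the work lies in
  matching degrees, index ranges and sums in \<open>Hom_grp\<close>.\<close>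

lemma F_family_eq:
  assumes "1 \<le> m"
  shows "(bd N \<star>\<^bsub>M,int (2*m)\<^esub> F_family (2*m)) \<ominus>\<^bsub>Hom_grp M N (int (2*m-1))\<^esub> (F_family (2*m) \<star>\<^bsub>M,-1\<^esub> bd M)
        = (\<Oplus>\<^bsub>Hom_grp M N (int (2*m-1))\<^esub>i\<in>{0..<m}.
            (F_family (2*i) \<star>\<^bsub>M,int (2*(m-i)-1)\<^esub> H_family (2*(m-i)-1))
              \<ominus>\<^bsub>Hom_grp M N (int (2*m-1))\<^esub> (L_family (2*(m-i)-1) \<star>\<^bsub>M,int (2*i)\<^esub> F_family (2*i)))"
    (is "?d1 \<ominus>\<^bsub>_\<^esub> ?d2 = finsum _ (\<lambda>i. ?a i \<ominus>\<^bsub>_\<^esub> ?b i) _")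
proof -
  note Mc = M.chain_complex_axioms and Nc = N.chain_complex_axioms
  from assms obtain k where m: "m = Suc k" by (cases m) auto
  let ?deg = "2 * int k + 1"
  have deg: "int (2 * m - 1) = ?deg" and ivl: "{0..<m} = {..k}"
    using m by auto
  \<comment> \<open>With m = k+1 the truncated subtraction becomes an explicit odd number, the shape
    in which \<open>family_apply\<close> and \<open>family_closed\<close> are stated.\<close>
  have idx: "2 * (m - i) - 1 = Suc (2 * (k - i))" if "i \<in> {..k}" for i
    using that m by auto
  have sum_closed: "?a i \<in> graded_maps M N ?deg" "?b i \<in> graded_maps M N ?deg" if "i \<in> {..k}" for i
    unfolding idx[OF that] using that
    by (auto simp: of_nat_diff intro!: graded_comp_graded_maps[OF Mc Mc Nc family_closed(3) family_closed(1)[OF refl]]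
        graded_comp_graded_maps[OF Mc Nc Nc family_closed(1) family_closed(4)[OF refl]])
  have bd_closed: "?d1 \<in> graded_maps M N ?deg" "?d2 \<in> graded_maps M N ?deg"
    by (intro bd_comp_closed[OF Mc Nc family_closed(1)] comp_bd_closed[OF Mc Nc family_closed(1)[OF refl]]; simp add: m)+
  show ?thesis
    unfolding deg ivl
  proof (rule graded_maps_eqI[OF Mc Nc graded_maps_minus[OF Mc Nc bd_closed]
        graded_maps_finsum[OF Mc Nc graded_maps_minus[OF Mc Nc sum_closed]]])
    fix n x assume x: "x \<in> carrier (grp M n)"
    have summand: "(?a i \<ominus>\<^bsub>Hom_grp M N ?deg\<^esub> ?b i) n x =
        strong_F i (n + 2 * int (k - i) + 1) (strong_H (k - i) n x)
        \<ominus>\<^bsub>grp N (n + 2 * int k + 1)\<^esub> strong_L (k - i) (n + 2 * int i) (strong_F i n x)" if "i \<in> {..k}" for i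
      using sum_closed[OF that] x that unfolding idx[OF that] by (simp add: Mc Nc add_ac)
    \<comment> \<open>\<open>Suc k\<close> is folded into \<open>m\<close> so that the family index
      keeps the shape \<open>2 * m\<close>, and is unfolded again for the degrees.\<close>
    have "(?d1 \<ominus>\<^bsub>Hom_grp M N ?deg\<^esub> ?d2) n x = bd N (n + 2 * int k + 2) (strong_F (Suc k) n x)
        \<ominus>\<^bsub>grp N (n + 2 * int k + 1)\<^esub> strong_F (Suc k) (n - 1) (bd M n x)"
      using bd_closed x by (simp add: m[symmetric] Mc Nc add_ac) (simp add: m)
    also note strong_F_bd_Suc[OF x]
    also have "(\<Oplus>\<^bsub>grp N (n + 2 * int k + 1)\<^esub>i\<in>{..k}.
        strong_F i (n + 2 * int (k - i) + 1) (strong_H (k - i) n x)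
        \<ominus>\<^bsub>grp N (n + 2 * int k + 1)\<^esub> strong_L (k - i) (n + 2 * int i) (strong_F i n x))
      = (\<Oplus>\<^bsub>grp N (n + ?deg)\<^esub>i\<in>{..k}. (?a i \<ominus>\<^bsub>Hom_grp M N ?deg\<^esub> ?b i) n x)"
      unfolding add.assoc[symmetric]
    proof (intro N.grp.finsum_cong' refl summand[symmetric, unfolded add.assoc[symmetric]] funcsetI)
      fix i assume i: "i \<in> {..k}"
      have "(?a i \<ominus>\<^bsub>Hom_grp M N ?deg\<^esub> ?b i) \<in> graded_maps M N ?deg"
        using i by (intro graded_maps_minus[OF Mc Nc] sum_closed)
      then show "(?a i \<ominus>\<^bsub>Hom_grp M N ?deg\<^esub> ?b i) n x \<in> carrier (grp N (n + 2 * int k + 1))"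
        using x by (intro graded_hom.closed[OF graded_maps_hom[OF Mc Nc]]) simp_all
    qed
    also have "\<dots> = (\<Oplus>\<^bsub>Hom_grp M N ?deg\<^esub>i\<in>{..k}. ?a i \<ominus>\<^bsub>Hom_grp M N ?deg\<^esub> ?b i) n x"
      using x by (intro Hom_grp_finsum_apply[OF Mc Nc, symmetric] graded_maps_minus[OF Mc Nc] sum_closed) auto
    finally show "(?d1 \<ominus>\<^bsub>Hom_grp M N ?deg\<^esub> ?d2) n x =
        (\<Oplus>\<^bsub>Hom_grp M N ?deg\<^esub>i\<in>{..k}. ?a i \<ominus>\<^bsub>Hom_grp M N ?deg\<^esub> ?b i) n x" .
  qed
qed

text \<open>The blocks come from the cone of \<open>F\<close>, which is not symmetric in M and N, so
  this is not the swapped \<open>F_family_eq\<close>. Here \<open>strong_G_bd\<close> covers every m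
  from 1 on.\<close>

lemma G_family_eq:
  assumes "1 \<le> m"
  shows "(bd M \<star>\<^bsub>N,int (2*m)\<^esub> G_family (2*m)) \<ominus>\<^bsub>Hom_grp N M (int (2*m-1))\<^esub> (G_family (2*m) \<star>\<^bsub>N,-1\<^esub> bd N)
        = (\<Oplus>\<^bsub>Hom_grp N M (int (2*m-1))\<^esub>i\<in>{0..<m}.
            (G_family (2*i) \<star>\<^bsub>N,int (2*(m-i)-1)\<^esub> L_family (2*(m-i)-1))
              \<ominus>\<^bsub>Hom_grp N M (int (2*m-1))\<^esub> (H_family (2*(m-i)-1) \<star>\<^bsub>N,int (2*i)\<^esub> G_family (2*i)))"
    (is "?d1 \<ominus>\<^bsub>_\<^esub> ?d2 = finsum _ (\<lambda>i. ?a i \<ominus>\<^bsub>_\<^esub> ?b i) _")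
proof -
  note Mc = N.chain_complex_axioms and Nc = M.chain_complex_axioms
  from assms obtain k where m: "m = Suc k" by (cases m) auto
  let ?deg = "2 * int k + 1"
  have deg: "int (2 * m - 1) = ?deg" and ivl: "{0..<m} = {..k}"
    using m by auto
  have idx: "2 * (m - i) - 1 = Suc (2 * (k - i))" if "i \<in> {..k}" for i
    using that m by auto
  have sum_closed: "?a i \<in> graded_maps N M ?deg" "?b i \<in> graded_maps N M ?deg" if "i \<in> {..k}" for i
    unfolding idx[OF that] using that
    by (auto simp: of_nat_diff intro!: graded_comp_graded_maps[OF Mc Mc Nc family_closed(4) family_closed(2)[OF refl]]
        graded_comp_graded_maps[OF Mc Nc Nc family_closed(2) family_closed(3)[OF refl]])
  have bd_closed: "?d1 \<in> graded_maps N M ?deg" "?d2 \<in> graded_maps N M ?deg"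
    by (intro bd_comp_closed[OF Mc Nc family_closed(2)] comp_bd_closed[OF Mc Nc family_closed(2)[OF refl]]; simp add: m)+
  show ?thesis
    unfolding deg ivl
  proof (rule graded_maps_eqI[OF Mc Nc graded_maps_minus[OF Mc Nc bd_closed]
        graded_maps_finsum[OF Mc Nc graded_maps_minus[OF Mc Nc sum_closed]]])
    fix n x assume x: "x \<in> carrier (grp N n)"
    have summand: "(?a i \<ominus>\<^bsub>Hom_grp N M ?deg\<^esub> ?b i) n x =
        strong_G i (n + 2 * int (k - i) + 1) (strong_L (k - i) n x)
        \<ominus>\<^bsub>grp M (n + 2 * int k + 1)\<^esub> strong_H (k - i) (n + 2 * int i) (strong_G i n x)" if "i \<in> {..k}" for i
      using sum_closed[OF that] x that unfolding idx[OF that] by (simp add: Mc Nc add_ac)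
    have "(?d1 \<ominus>\<^bsub>Hom_grp N M ?deg\<^esub> ?d2) n x = bd M (n + 2 * int k + 2) (strong_G (Suc k) n x)
        \<ominus>\<^bsub>grp M (n + 2 * int k + 1)\<^esub> strong_G (Suc k) (n - 1) (bd N n x)"
      using bd_closed x by (simp add: m[symmetric] Mc Nc add_ac) (simp add: m)
    also note strong_G_bd[OF x]
    also have "(\<Oplus>\<^bsub>grp M (n + 2 * int k + 1)\<^esub>i\<in>{..k}.
        strong_G i (n + 2 * int (k - i) + 1) (strong_L (k - i) n x)
        \<ominus>\<^bsub>grp M (n + 2 * int k + 1)\<^esub> strong_H (k - i) (n + 2 * int i) (strong_G i n x))
      = (\<Oplus>\<^bsub>grp M (n + ?deg)\<^esub>i\<in>{..k}. (?a i \<ominus>\<^bsub>Hom_grp N M ?deg\<^esub> ?b i) n x)"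
      unfolding add.assoc[symmetric]
    proof (intro M.grp.finsum_cong' refl summand[symmetric, unfolded add.assoc[symmetric]] funcsetI)
      fix i assume i: "i \<in> {..k}"
      have "(?a i \<ominus>\<^bsub>Hom_grp N M ?deg\<^esub> ?b i) \<in> graded_maps N M ?deg"
        using i by (intro graded_maps_minus[OF Mc Nc] sum_closed)
      then show "(?a i \<ominus>\<^bsub>Hom_grp N M ?deg\<^esub> ?b i) n x \<in> carrier (grp M (n + 2 * int k + 1))"
        using x by (intro graded_hom.closed[OF graded_maps_hom[OF Mc Nc]]) simp_all
    qed
    also have "\<dots> = (\<Oplus>\<^bsub>Hom_grp N M ?deg\<^esub>i\<in>{..k}. ?a i \<ominus>\<^bsub>Hom_grp N M ?deg\<^esub> ?b i) n x"
      using x by (intro Hom_grp_finsum_apply[OF Mc Nc, symmetric] graded_maps_minus[OF Mc Nc] sum_closed) auto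
    finally show "(?d1 \<ominus>\<^bsub>Hom_grp N M ?deg\<^esub> ?d2) n x =
        (\<Oplus>\<^bsub>Hom_grp N M ?deg\<^esub>i\<in>{..k}. ?a i \<ominus>\<^bsub>Hom_grp N M ?deg\<^esub> ?b i) n x" .
  qed
qed

text \<open>Pointwise this is \<open>strong_H_bd\<close>. The two sums have different ranges: the
  products GF include both ends j = 0 and j = m, while the products HH stop one earlier.\<close>

lemma H_family_eq:
  assumes "1 \<le> m"
  shows "(bd M \<star>\<^bsub>M,int (2*m+1)\<^esub> H_family (2*m+1)) \<oplus>\<^bsub>Hom_grp M M (int (2*m))\<^esub> (H_family (2*m+1) \<star>\<^bsub>M,-1\<^esub> bd M)
        = (\<Oplus>\<^bsub>Hom_grp M M (int (2*m))\<^esub>j\<in>{0..m}.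
            G_family (2*j) \<star>\<^bsub>M,int (2*(m-j))\<^esub> F_family (2*(m-j)))
          \<ominus>\<^bsub>Hom_grp M M (int (2*m))\<^esub>
          (\<Oplus>\<^bsub>Hom_grp M M (int (2*m))\<^esub>j\<in>{0..<m}.
            H_family (2*j+1) \<star>\<^bsub>M,int (2*(m-j)-1)\<^esub> H_family (2*(m-j)-1))"
    (is "?d1 \<oplus>\<^bsub>_\<^esub> ?d2 = finsum _ ?a _ \<ominus>\<^bsub>_\<^esub> finsum _ ?b _")
proof -
  note Mc = M.chain_complex_axioms and Nc = N.chain_complex_axioms
  from assms obtain k where m: "m = Suc k" by (cases m) auto
  let ?deg = "2 * int k + 2"
  have deg: "int (2 * m) = ?deg" and ivl: "{0..<m} = {..k}" "{0..m} = {..Suc k}"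
    using m by auto
  have idx: "2 * (m - i) - 1 = Suc (2 * (k - i))" if "i \<in> {..k}" for i
    using that m by auto
  have a_closed: "?a i \<in> graded_maps M M ?deg" if "i \<in> {..Suc k}" for i
    using that m
    by (auto simp: of_nat_diff intro!: graded_comp_graded_maps[OF Mc Nc Mc family_closed(1) family_closed(2)[OF refl]])
  have b_closed: "?b i \<in> graded_maps M M ?deg" if "i \<in> {..k}" for i
    unfolding idx[OF that] using that
    by (auto simp: of_nat_diff intro!: graded_comp_graded_maps[OF Mc Mc Mc family_closed(3) family_closed(3)[OF refl]])
  have bd_closed: "?d1 \<in> graded_maps M M ?deg" "?d2 \<in> graded_maps M M ?deg"
    unfolding Suc_eq_plus1[symmetric]
    by (intro bd_comp_closed[OF Mc Mc family_closed(3)] comp_bd_closed[OF Mc Mc family_closed(3)[OF refl]]; simp add: m)+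
  have sum_closed: "finsum (Hom_grp M M ?deg) ?a {..Suc k} \<in> graded_maps M M ?deg"
    "finsum (Hom_grp M M ?deg) ?b {..k} \<in> graded_maps M M ?deg"
    by (intro graded_maps_finsum[OF Mc Mc] a_closed b_closed; assumption)+
  show ?thesis
    unfolding deg ivl
  proof (rule graded_maps_eqI[OF Mc Mc graded_maps_add[OF Mc Mc bd_closed] graded_maps_minus[OF Mc Mc sum_closed]])
    fix n x assume x: "x \<in> carrier (grp M n)"
    have a: "?a i n x = strong_G i (n + 2 * int (Suc k - i)) (strong_F (Suc k - i) n x)" for i
      using x by (simp add: m)
    have b: "?b i n x = strong_H i (n + 2 * int (k - i) + 1) (strong_H (k - i) n x)" if "i \<in> {..k}" for i
      using x unfolding idx[OF that] by (simp add: add_ac)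
    have A: "finsum (Hom_grp M M ?deg) ?a {..Suc k} n x =
        (\<Oplus>\<^bsub>grp M (n + 2 * int k + 2)\<^esub>i\<in>{..Suc k}. strong_G i (n + 2 * int (Suc k - i)) (strong_F (Suc k - i) n x))"
      using Hom_grp_finsum_apply[OF Mc Mc a_closed finite_atMost x] unfolding a add.assoc[symmetric] .
    have "finsum (Hom_grp M M ?deg) ?b {..k} n x = (\<Oplus>\<^bsub>grp M (n + ?deg)\<^esub>i\<in>{..k}. ?b i n x)"
      using x by (intro Hom_grp_finsum_apply[OF Mc Mc] b_closed) auto
    also have "\<dots> = (\<Oplus>\<^bsub>grp M (n + 2 * int k + 2)\<^esub>i\<in>{..k}. strong_H i (n + 2 * int (k - i) + 1) (strong_H (k - i) n x))"
      unfolding add.assoc[symmetric]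
      using x by (intro M.grp.finsum_cong' refl b funcsetI) (auto simp: of_nat_diff)
    finally have B: "finsum (Hom_grp M M ?deg) ?b {..k} n x = \<dots>" .
    have "(?d1 \<oplus>\<^bsub>Hom_grp M M ?deg\<^esub> ?d2) n x = bd M (n + 2 * int k + 3) (strong_H (Suc k) n x)
        \<oplus>\<^bsub>grp M (n + 2 * int k + 2)\<^esub> strong_H (Suc k) (n - 1) (bd M n x)"
      using x by (simp add: m[symmetric] Mc add_ac) (simp add: m add_ac)
    also note strong_H_bd[OF x]
    also have "(\<Oplus>\<^bsub>grp M (n + 2 * int k + 2)\<^esub>i\<in>{..Suc k}. strong_G i (n + 2 * int (Suc k - i)) (strong_F (Suc k - i) n x))
        \<ominus>\<^bsub>grp M (n + 2 * int k + 2)\<^esub>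
        (\<Oplus>\<^bsub>grp M (n + 2 * int k + 2)\<^esub>i\<in>{..k}. strong_H i (n + 2 * int (k - i) + 1) (strong_H (k - i) n x))
      = (finsum (Hom_grp M M ?deg) ?a {..Suc k} \<ominus>\<^bsub>Hom_grp M M ?deg\<^esub> finsum (Hom_grp M M ?deg) ?b {..k}) n x"
      unfolding Hom_grp_minus_apply[OF Mc Mc sum_closed x] A B by (simp add: add_ac)
    finally show "(?d1 \<oplus>\<^bsub>Hom_grp M M ?deg\<^esub> ?d2) n x =
        (finsum (Hom_grp M M ?deg) ?a {..Suc k} \<ominus>\<^bsub>Hom_grp M M ?deg\<^esub> finsum (Hom_grp M M ?deg) ?b {..k}) n x" .
  qed
qed

lemma L_family_eq:
  assumes "1 \<le> m"
  shows "(bd N \<star>\<^bsub>N,int (2*m+1)\<^esub> L_family (2*m+1)) \<oplus>\<^bsub>Hom_grp N N (int (2*m))\<^esub> (L_family (2*m+1) \<star>\<^bsub>N,-1\<^esub> bd N)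
        = (\<Oplus>\<^bsub>Hom_grp N N (int (2*m))\<^esub>j\<in>{0..m}.
            F_family (2*j) \<star>\<^bsub>N,int (2*(m-j))\<^esub> G_family (2*(m-j)))
          \<ominus>\<^bsub>Hom_grp N N (int (2*m))\<^esub>
          (\<Oplus>\<^bsub>Hom_grp N N (int (2*m))\<^esub>j\<in>{0..<m}.
            L_family (2*j+1) \<star>\<^bsub>N,int (2*(m-j)-1)\<^esub> L_family (2*(m-j)-1))"
    (is "?d1 \<oplus>\<^bsub>_\<^esub> ?d2 = finsum _ ?a _ \<ominus>\<^bsub>_\<^esub> finsum _ ?b _")
proof -
  note Mc = N.chain_complex_axioms and Nc = M.chain_complex_axioms
  from assms obtain k where m: "m = Suc k" by (cases m) auto
  let ?deg = "2 * int k + 2"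
  have deg: "int (2 * m) = ?deg" and ivl: "{0..<m} = {..k}" "{0..m} = {..Suc k}"
    using m by auto
  have idx: "2 * (m - i) - 1 = Suc (2 * (k - i))" if "i \<in> {..k}" for i
    using that m by auto
  have a_closed: "?a i \<in> graded_maps N N ?deg" if "i \<in> {..Suc k}" for i
    using that m
    by (auto simp: of_nat_diff intro!: graded_comp_graded_maps[OF Mc Nc Mc family_closed(2) family_closed(1)[OF refl]])
  have b_closed: "?b i \<in> graded_maps N N ?deg" if "i \<in> {..k}" for i
    unfolding idx[OF that] using that
    by (auto simp: of_nat_diff intro!: graded_comp_graded_maps[OF Mc Mc Mc family_closed(4) family_closed(4)[OF refl]])
  have bd_closed: "?d1 \<in> graded_maps N N ?deg" "?d2 \<in> graded_maps N N ?deg"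
    unfolding Suc_eq_plus1[symmetric]
    by (intro bd_comp_closed[OF Mc Mc family_closed(4)] comp_bd_closed[OF Mc Mc family_closed(4)[OF refl]]; simp add: m)+
  have sum_closed: "finsum (Hom_grp N N ?deg) ?a {..Suc k} \<in> graded_maps N N ?deg"
    "finsum (Hom_grp N N ?deg) ?b {..k} \<in> graded_maps N N ?deg"
    by (intro graded_maps_finsum[OF Mc Mc] a_closed b_closed; assumption)+
  show ?thesis
    unfolding deg ivl
  proof (rule graded_maps_eqI[OF Mc Mc graded_maps_add[OF Mc Mc bd_closed] graded_maps_minus[OF Mc Mc sum_closed]])
    fix n x assume x: "x \<in> carrier (grp N n)"
    have a: "?a i n x = strong_F i (n + 2 * int (Suc k - i)) (strong_G (Suc k - i) n x)" for i
      using x by (simp add: m)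
    have b: "?b i n x = strong_L i (n + 2 * int (k - i) + 1) (strong_L (k - i) n x)" if "i \<in> {..k}" for i
      using x unfolding idx[OF that] by (simp add: add_ac)
    have A: "finsum (Hom_grp N N ?deg) ?a {..Suc k} n x =
        (\<Oplus>\<^bsub>grp N (n + 2 * int k + 2)\<^esub>i\<in>{..Suc k}. strong_F i (n + 2 * int (Suc k - i)) (strong_G (Suc k - i) n x))"
      using Hom_grp_finsum_apply[OF Mc Mc a_closed finite_atMost x] unfolding a add.assoc[symmetric] .
    have "finsum (Hom_grp N N ?deg) ?b {..k} n x = (\<Oplus>\<^bsub>grp N (n + ?deg)\<^esub>i\<in>{..k}. ?b i n x)"
      using x by (intro Hom_grp_finsum_apply[OF Mc Mc] b_closed) auto
    also have "\<dots> = (\<Oplus>\<^bsub>grp N (n + 2 * int k + 2)\<^esub>i\<in>{..k}. strong_L i (n + 2 * int (k - i) + 1) (strong_L (k - i) n x))"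
      unfolding add.assoc[symmetric]
      using x by (intro N.grp.finsum_cong' refl b funcsetI) (auto simp: of_nat_diff)
    finally have B: "finsum (Hom_grp N N ?deg) ?b {..k} n x = \<dots>" .
    have "(?d1 \<oplus>\<^bsub>Hom_grp N N ?deg\<^esub> ?d2) n x = bd N (n + 2 * int k + 3) (strong_L (Suc k) n x)
        \<oplus>\<^bsub>grp N (n + 2 * int k + 2)\<^esub> strong_L (Suc k) (n - 1) (bd N n x)"
      using x by (simp add: m[symmetric] Mc add_ac) (simp add: m add_ac)
    also note strong_L_bd[OF x]
    also have "(\<Oplus>\<^bsub>grp N (n + 2 * int k + 2)\<^esub>i\<in>{..Suc k}. strong_F i (n + 2 * int (Suc k - i)) (strong_G (Suc k - i) n x))
        \<ominus>\<^bsub>grp N (n + 2 * int k + 2)\<^esub>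
        (\<Oplus>\<^bsub>grp N (n + 2 * int k + 2)\<^esub>i\<in>{..k}. strong_L i (n + 2 * int (k - i) + 1) (strong_L (k - i) n x))
      = (finsum (Hom_grp N N ?deg) ?a {..Suc k} \<ominus>\<^bsub>Hom_grp N N ?deg\<^esub> finsum (Hom_grp N N ?deg) ?b {..k}) n x"
      unfolding Hom_grp_minus_apply[OF Mc Mc sum_closed x] A B by (simp add: add_ac)
    finally show "(?d1 \<oplus>\<^bsub>Hom_grp N N ?deg\<^esub> ?d2) n x =
        (finsum (Hom_grp N N ?deg) ?a {..Suc k} \<ominus>\<^bsub>Hom_grp N N ?deg\<^esub> finsum (Hom_grp N N ?deg) ?b {..k}) n x" .
  qed
qed

text \<open>The sufficiency: a filling \<open>K\<close> of the one class FH - LF yields the whole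
  extension. The equations without \<open>m\<close> are those of the given homotopy equivalence, the
  others those of the blocks.\<close>

lemma extends_to_strong:
  assumes "F \<in> graded_maps M N 0" "G \<in> graded_maps N M 0" "H \<in> graded_maps M M 1" "L \<in> graded_maps N N 1"
  shows "extends_to_strong M N F G H L"
proof -
  note Mc = M.chain_complex_axioms and Nc = N.chain_complex_axioms
  \<comment> \<open>Agreement on the carriers is equality of functions here, as both sides are
    extensional.\<close>
  have "F_family 0 = F"
    using family_closed(1)[of 0 0] family_apply(1)[of _ _ 0]
    by (intro graded_maps_eqI[OF Mc Nc _ assms(1)]) simp_all
  moreover have "G_family 0 = G"
    using family_closed(2)[of 0 0] family_apply(2)[of _ _ 0]
    by (intro graded_maps_eqI[OF Nc Mc _ assms(2)]) (simp_all add: strong_0)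
  moreover have "H_family 1 = H"
    using family_closed(3)[of 1 0] family_apply(3)[of _ _ 0]
    by (intro graded_maps_eqI[OF Mc Mc _ assms(3)]) (simp_all add: strong_0)
  moreover have "L_family 1 = L"
    using family_closed(4)[of 1 0] family_apply(4)[of _ _ 0]
    by (intro graded_maps_eqI[OF Nc Nc _ assms(4)]) (simp_all add: strong_0)
  ultimately have 0: "F_family 0 = F" "G_family 0 = G" "H_family 1 = H" "L_family 1 = L" .
  have he: "homotopy_equivalence M N F G H L"
    using assms by (simp add: homotopy_equivalence_iff Mc Nc F_bd G_bd H_bd L_bd)
  have "strong_homotopy_equivalence M N F_family G_family H_family L_family"
    using he unfolding strong_homotopy_equivalence_def homotopy_equivalence_def 0
    by (elim conjE, intro conjI allI impI F_family_eq G_family_eq H_family_eq L_family_eq)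
      (assumption | simp add: family_closed)+
  then show ?thesis
    unfolding extends_to_strong_def using 0 by blast
qed

end

section \<open>Changing one homotopy\<close>

text \<open>With \<open>o = FH - LF\<close>, a cycle, one has \<open>FH' - LF = o - FGo = -(dL + Ld)o\<close>, which is the
  boundary of \<open>-Lo\<close>.\<close>
lemma homotopy_equivalence_modify_H:
  assumes M: "chain_complex M" and N: "chain_complex N" and he: "homotopy_equivalence M N F G H L"
    and H': "H' = H \<ominus>\<^bsub>Hom_grp M M 1\<^esub> (G \<star>\<^bsub>M,1\<^esub> ((F \<star>\<^bsub>M,1\<^esub> H) \<ominus>\<^bsub>Hom_grp M N 1\<^esub> (L \<star>\<^bsub>M,0\<^esub> F)))"
  shows "homotopy_equivalence M N F G H' L \<and> obstruction_vanishes M N F G H' L \<and> extends_to_strong M N F G H' L"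
proof -
  interpret M: chain_complex M by fact
  interpret N: chain_complex N by fact
  have m: "F \<in> graded_maps M N 0" "G \<in> graded_maps N M 0" "H \<in> graded_maps M M 1" "L \<in> graded_maps N N 1"
    using he unfolding homotopy_equivalence_def by auto
  interpret F: graded_hom M N 0 F by (rule graded_maps_hom[OF M N m(1)])
  interpret G: graded_hom N M 0 G by (rule graded_maps_hom[OF N M m(2)])
  interpret H: graded_hom M M 1 H by (rule graded_maps_hom[OF M M m(3)])
  interpret L: graded_hom N N 1 L by (rule graded_maps_hom[OF N N m(4)])
  have F_bd: "F (n - 1) (bd M n x) = bd N n (F n x)" if "x \<in> carrier (grp M n)" for n x
    using he that by (simp add: homotopy_equivalence_iff[OF M N])
  have G_bd: "G (n - 1) (bd N n y) = bd M n (G n y)" if "y \<in> carrier (grp N n)" for n y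
    using he that by (simp add: homotopy_equivalence_iff[OF M N])
  have H_bd: "bd M (n + 1) (H n x) = G n (F n x) \<ominus>\<^bsub>grp M n\<^esub> x \<ominus>\<^bsub>grp M n\<^esub> H (n - 1) (bd M n x)"
    if "x \<in> carrier (grp M n)" for n x
    using he that by (simp add: homotopy_equivalence_iff[OF M N] M.grp.abelian_simps)
  have L_bd: "bd N (n + 1) (L n y) = F n (G n y) \<ominus>\<^bsub>grp N n\<^esub> y \<ominus>\<^bsub>grp N n\<^esub> L (n - 1) (bd N n y)"
    if "y \<in> carrier (grp N n)" for n y
    using he that by (simp add: homotopy_equivalence_iff[OF M N] N.grp.abelian_simps)
  define ob where "ob = (F \<star>\<^bsub>M,1\<^esub> H) \<ominus>\<^bsub>Hom_grp M N 1\<^esub> (L \<star>\<^bsub>M,0\<^esub> F)"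
  have comp: "F \<star>\<^bsub>M,1\<^esub> H \<in> graded_maps M N 1" "L \<star>\<^bsub>M,0\<^esub> F \<in> graded_maps M N 1"
    using graded_comp_graded_maps[OF M M N m(3,1)] graded_comp_graded_maps[OF M N N m(1,4)] by simp_all
  then have ob: "ob \<in> graded_maps M N 1"
    unfolding ob_def using M N by simp
  interpret ob: graded_hom M N 1 ob by (rule graded_maps_hom[OF M N ob])
  have ob_apply: "ob n x = F (n + 1) (H n x) \<ominus>\<^bsub>grp N (n + 1)\<^esub> L n (F n x)" if "x \<in> carrier (grp M n)" for n x
    using that comp by (simp add: ob_def M N)
  have Go: "G \<star>\<^bsub>M,1\<^esub> ob \<in> graded_maps M M 1"
    using graded_comp_graded_maps[OF M N M ob m(2)] by simp
  have H'_closed: "H' \<in> graded_maps M M 1"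
    unfolding H' ob_def[symmetric] using m Go M by simp
  interpret H': graded_hom M M 1 H' by (rule graded_maps_hom[OF M M H'_closed])
  have H'_apply: "H' n x = H n x \<ominus>\<^bsub>grp M (n + 1)\<^esub> G (n + 1) (ob n x)" if "x \<in> carrier (grp M n)" for n x
    unfolding H' ob_def[symmetric] using m Go M that by simp
  \<comment> \<open>The obstruction is a cycle: FGF - F occurs in both d(FH) and d(LF) and cancels,
    leaving -FHd + LFd.\<close>
  have ob_bd: "bd N (n + 1) (ob n x) = \<ominus>\<^bsub>grp N n\<^esub> ob (n - 1) (bd M n x)" if x: "x \<in> carrier (grp M n)" for n x
  proof -
    have "bd N (n + 1) (F (n + 1) (H n x)) = F n (bd M (n + 1) (H n x))"
      using F_bd[of "H n x" "n + 1"] x by simp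
    then show ?thesis
      using x by (simp add: ob_apply H_bd L_bd F_bd) (simp add: N.grp.abelian_simps)
  qed
  \<comment> \<open>As \<open>G\<close> is a chain map, G applied to the cycle \<open>ob\<close> is
    again a cycle, so subtracting it leaves dH + Hd unchanged.\<close>
  have H'_bd: "bd M (n + 1) (H' n x) \<oplus>\<^bsub>grp M n\<^esub> H' (n - 1) (bd M n x) = G n (F n x) \<ominus>\<^bsub>grp M n\<^esub> x"
    if x: "x \<in> carrier (grp M n)" for n x
  proof -
    have "bd M (n + 1) (G (n + 1) (ob n x)) = G n (bd N (n + 1) (ob n x))"
      using G_bd[of "ob n x" "n + 1"] x by simp
    then show ?thesis
      using x by (simp add: H'_apply H_bd ob_bd) (simp add: M.grp.abelian_simps)
  qed
  have he': "homotopy_equivalence M N F G H' L"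
    unfolding homotopy_equivalence_iff[OF M N]
    using m H'_closed H'_bd F_bd G_bd L_bd by (simp add: N.grp.abelian_simps)
  define K where "K = (\<lambda>n x. \<ominus>\<^bsub>grp N (n + 2)\<^esub> L (n + 1) (ob n x))"
  have "graded_hom M N 2 K"
    by (rule graded_homI) (simp_all add: K_def M.grp.abelian_group_axioms N.grp.abelian_group_axioms N.grp.minus_add add_ac)
  then interpret filled_homotopy_equivalence M N F G H' L K
  proof (intro filled_homotopy_equivalence.intro filled_homotopy_equivalence_axioms.intro)
    fix n x assume x: "x \<in> carrier (grp M n)"
    \<comment> \<open>The homotopy identity for \<open>L\<close> at \<open>ob n x\<close>; the last
      sign is positive because d anticommutes with \<open>ob\<close>.\<close>
    have "bd N (n + 2) (L (n + 1) (ob n x)) = F (n + 1) (G (n + 1) (ob n x)) \<ominus>\<^bsub>grp N (n + 1)\<^esub> ob n x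
        \<oplus>\<^bsub>grp N (n + 1)\<^esub> L n (ob (n - 1) (bd M n x))"
    proof -
      have "n + 1 + 1 = n + 2" by simp
      from L_bd[of "ob n x" "n + 1", unfolded this] show ?thesis
        using x by (simp add: ob_bd N.grp.minus_eq N.grp.minus_minus)
    qed
    moreover have "F (n + 1) (H n x) = ob n x \<oplus>\<^bsub>grp N (n + 1)\<^esub> L n (F n x)"
      using x by (simp add: ob_apply N.grp.abelian_simps)
    ultimately show "bd N (n + 2) (K n x) \<ominus>\<^bsub>grp N (n + 1)\<^esub> K (n - 1) (bd M n x)
        = F (n + 1) (H' n x) \<ominus>\<^bsub>grp N (n + 1)\<^esub> L n (F n x)"
      using x by (simp add: K_def H'_apply) (simp add: N.grp.abelian_simps add_ac)
  qed (use F_bd G_bd H'_bd L_bd in \<open>simp_all add: M N F.graded_hom_axioms G.graded_hom_axioms H'.graded_hom_axioms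
      L.graded_hom_axioms N.grp.abelian_simps\<close>)
  have "extends_to_strong M N F G H' L"
    using m H'_closed by (intro extends_to_strong)
  \<comment> \<open>Only the obstruction on M has been filled explicitly; the vanishing of both
    classes is read off from the extension.\<close>
  then show ?thesis
    using he' extends_to_strong_imp_obstruction_vanishes[OF M N] by blast
qed

section \<open>Exchanging the roles of M and N\<close>

text \<open>With the two swap lemmas that follow it, this turns the result on changing
  \<open>H\<close> into the one on changing \<open>L\<close>.\<close>

lemma homotopy_equivalence_swap: "homotopy_equivalence N M G F L H \<longleftrightarrow> homotopy_equivalence M N F G H L"
  unfolding homotopy_equivalence_def by (rule iffI; elim conjE; intro conjI; assumption)

lemma obstruction_vanishes_swap: "obstruction_vanishes N M G F L H \<longleftrightarrow> obstruction_vanishes M N F G H L"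
  unfolding obstruction_vanishes_def obstruction_M_def obstruction_N_def by (rule conj_commute)

lemma extends_to_strong_swap_imp:
  assumes "extends_to_strong M N F G H L"
  shows "extends_to_strong N M G F L H"
proof -
  from assms obtain Fs Gs Hs Ls where s: "strong_homotopy_equivalence M N Fs Gs Hs Ls"
    and "Fs 0 = F" "Gs 0 = G" "Hs 1 = H" "Ls 1 = L"
    unfolding extends_to_strong_def by blast
  with strong_homotopy_equivalence_swap[OF s] show ?thesis
    unfolding extends_to_strong_def by blast
qed

lemma extends_to_strong_swap: "extends_to_strong N M G F L H \<longleftrightarrow> extends_to_strong M N F G H L"
  by (rule iffI) (rule extends_to_strong_swap_imp, assumption)+

theorem theorem13:
  fixes M :: "'a chain_cpx" and N :: "'b chain_cpx"
    and F :: "int \<Rightarrow> 'a \<Rightarrow> 'b" and G :: "int \<Rightarrow> 'b \<Rightarrow> 'a"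
    and H :: "int \<Rightarrow> 'a \<Rightarrow> 'a" and L :: "int \<Rightarrow> 'b \<Rightarrow> 'b"
  assumes "chain_complex M" and "chain_complex N"
    and "homotopy_equivalence M N F G H L"
  shows
    "(\<exists>H'. homotopy_equivalence M N F G H' L \<and>
        obstruction_vanishes M N F G H' L \<and> extends_to_strong M N F G H' L) \<and>
     (\<exists>L'. homotopy_equivalence M N F G H L' \<and>
        obstruction_vanishes M N F G H L' \<and> extends_to_strong M N F G H L') \<and>
     (let H' = H \<ominus>\<^bsub>Hom_grp M M 1\<^esub>
                 (G \<star>\<^bsub>M,1\<^esub> ((F \<star>\<^bsub>M,1\<^esub> H) \<ominus>\<^bsub>Hom_grp M N 1\<^esub> (L \<star>\<^bsub>M,0\<^esub> F)))
      in homotopy_equivalence M N F G H' L \<and>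
         obstruction_vanishes M N F G H' L \<and> extends_to_strong M N F G H' L) \<and>
     (let L' = L \<ominus>\<^bsub>Hom_grp N N 1\<^esub>
                 (F \<star>\<^bsub>N,1\<^esub> ((G \<star>\<^bsub>N,1\<^esub> L) \<ominus>\<^bsub>Hom_grp N M 1\<^esub> (H \<star>\<^bsub>N,0\<^esub> G)))
      in homotopy_equivalence M N F G H L' \<and>
         obstruction_vanishes M N F G H L' \<and> extends_to_strong M N F G H L')"
proof -
  note M = assms(1) and N = assms(2) and he = assms(3)
  note H = homotopy_equivalence_modify_H[OF M N he refl]
  have he': "homotopy_equivalence N M G F L H"
    by (rule homotopy_equivalence_swap[THEN iffD2, OF he])
  \<comment> \<open>For the swapped data (G, F, L, H) the same formula subtracts F(GL - HG) from
    \<open>L\<close>.\<close>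
  note L = homotopy_equivalence_modify_H[OF N M he' refl, unfolded homotopy_equivalence_swap[where M = M and N = N]
      obstruction_vanishes_swap[where M = M and N = N] extends_to_strong_swap[where M = M and N = N]]
  show ?thesis
    \<comment> \<open>The explicit changes also serve as witnesses of the two existence
      claims.\<close>
    unfolding Let_def by (rule conjI[OF _ conjI[OF _ conjI[OF H L]]]; rule exI; rule H L)
qed

end
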